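(* Let $p\in(1,+\infty)$ and let $V\colon\mathbb{R}^2\to\mathbb{R}$ be a $C^1$ positive coercive function with $|\nabla V(x)|\le CV^{3/2}(x)$ for a.e. $x$ and some $C>0$. Let \[ I(u)=\frac12\int_{\mathbb{R}^2}(|\nabla u|^2+V(x)u^2)\,dx-\frac1{p+1}\|u\|_2^2\int_{\mathbb{R}^2}V(x)|u|^{p+1}dx,\qquad u\in H^1_V(\mathbb{R}^2), \] \[ \mathcal N=\Big\{u\in H^1_V(\mathbb{R}^2): u\ne0,\ \int_{\mathbb{R}^2}(|\nabla u|^2+V(x)u^2)\,dx=\frac{p+3}{p+1}\|u\|_2^2\int_{\mathbb{R}^2}V(x)|u|^{p+1}dx\Big\}, \] and $\sigma=\inf_{\mathcal N}I$. If $\{u_n\}_n\subset\mathcal N$ satisfies $I(u_n)\to\sigma$, then, up to a subsequence, there exists $u_0\in H^1_V(\mathbb{R}^2)\setminus\{0\}$ such that $u_n\rightharpoonup u_0$ weakly in $H^1_V(\mathbb{R}^2)$.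
   Context: $H^1_V(\mathbb{R}^2)$ is the completion of $C_0^\infty(\mathbb{R}^2)$ with respect to the norm $\|u\|_V=\left(\int_{\mathbb{R}^2}(|\nabla u|^2+V|u|^2)\,dx\right)^{1/2}$; $\|\cdot\|_2$ is the $L^2$ norm. *)

theory Defs
  imports "HOL-Analysis.Analysis"
begin

type_synonym pt = "real^2"

definition grad :: "(pt \<Rightarrow> real) \<Rightarrow> pt \<Rightarrow> pt" where
  "grad f x = (\<chi> i. frechet_derivative f (at x) (axis i 1))"

fun Ck :: "nat \<Rightarrow> (pt \<Rightarrow> real) set" where
  "Ck 0 = {f. continuous_on UNIV f}"
| "Ck (Suc k) = {f. continuous_on UNIV f \<and>
      (\<exists>Df. (\<forall>x. (f has_derivative (\<lambda>h. Df x \<bullet> h)) (at x)) \<and>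
            (\<forall>i. (\<lambda>x. Df x $ i) \<in> Ck k))}"

definition smooth :: "(pt \<Rightarrow> real) set" where
  "smooth = (\<Inter>k. Ck k)"

definition test_fun :: "(pt \<Rightarrow> real) set" where
  "test_fun = {f. f \<in> smooth \<and> compact (closure {x. f x \<noteq> 0})}"

text \<open>Elements of H^1_V are represented as pairs (u, g) of a function and its
  (weak) gradient which are limits, in the norm
  (\<integral> |\<nabla>u|^2 + V u^2)^(1/2), of test functions and their gradients.
  This is the concrete realisation of the completion of C_0^infinity.\<close>
definition H1V :: "(pt \<Rightarrow> real) \<Rightarrow> ((pt \<Rightarrow> real) \<times> (pt \<Rightarrow> pt)) set" where
  "H1V V = {(u, g). u \<in> borel_measurable lborel \<and> g \<in> borel_measurable lborel \<and>
     (\<exists>\<phi>. (\<forall>n. \<phi> n \<in> test_fun) \<and>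
        (\<lambda>n. \<integral>\<^sup>+ x. ennreal ((norm (g x - grad (\<phi> n) x))\<^sup>2 + V x * (u x - \<phi> n x)\<^sup>2) \<partial>lborel)
          \<longlonglongrightarrow> 0)}"

definition innerV :: "(pt \<Rightarrow> real) \<Rightarrow> (pt \<Rightarrow> real) \<times> (pt \<Rightarrow> pt) \<Rightarrow> (pt \<Rightarrow> real) \<times> (pt \<Rightarrow> pt) \<Rightarrow> real" where
  "innerV V v w = (\<integral>x. snd v x \<bullet> snd w x + V x * fst v x * fst w x \<partial>lborel)"

definition normV_sq :: "(pt \<Rightarrow> real) \<Rightarrow> (pt \<Rightarrow> real) \<times> (pt \<Rightarrow> pt) \<Rightarrow> real" where
  "normV_sq V v = innerV V v v"

definition L2_sq :: "(pt \<Rightarrow> real) \<Rightarrow> real" where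
  "L2_sq u = (\<integral>x. (u x)\<^sup>2 \<partial>lborel)"

definition nonlin :: "real \<Rightarrow> (pt \<Rightarrow> real) \<Rightarrow> (pt \<Rightarrow> real) \<Rightarrow> real" where
  "nonlin p V u = (\<integral>x. V x * \<bar>u x\<bar> powr (p + 1) \<partial>lborel)"

definition Ifun :: "real \<Rightarrow> (pt \<Rightarrow> real) \<Rightarrow> (pt \<Rightarrow> real) \<times> (pt \<Rightarrow> pt) \<Rightarrow> real" where
  "Ifun p V v = 1/2 * normV_sq V v - 1 / (p + 1) * L2_sq (fst v) * nonlin p V (fst v)"

definition nonzeroV :: "(pt \<Rightarrow> real) \<times> (pt \<Rightarrow> pt) \<Rightarrow> bool" where
  "nonzeroV v \<longleftrightarrow> \<not> (AE x in lborel. fst v x = 0)"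

definition Nehari :: "real \<Rightarrow> (pt \<Rightarrow> real) \<Rightarrow> ((pt \<Rightarrow> real) \<times> (pt \<Rightarrow> pt)) set" where
  "Nehari p V = {v \<in> H1V V. nonzeroV v \<and>
     normV_sq V v = (p + 3) / (p + 1) * L2_sq (fst v) * nonlin p V (fst v)}"

definition weak_conv_V :: "(pt \<Rightarrow> real) \<Rightarrow> (nat \<Rightarrow> (pt \<Rightarrow> real) \<times> (pt \<Rightarrow> pt)) \<Rightarrow> (pt \<Rightarrow> real) \<times> (pt \<Rightarrow> pt) \<Rightarrow> bool" where
  "weak_conv_V V s v \<longleftrightarrow> (\<forall>w \<in> H1V V. (\<lambda>n. innerV V (s n) w) \<longlonglongrightarrow> innerV V v w)"

end

theory Submission
  imports Defs "HOL-Complex_Analysis.Great_Picard"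
begin

text \<open>On the Nehari set \<open>I(u) = (1/2 - 1/(p+3)) \<parallel>u\<parallel>\<^sub>V\<^sup>2\<close>, so a minimising sequence is bounded and has a weakly
  convergent subsequence. The Gagliardo--Nirenberg inequality \<open>\<parallel>w\<parallel>\<^sub>2 \<le> \<parallel>\<nabla>w\<parallel>\<^sub>1\<close> in the plane, applied to
  \<open>w = \<surd>V u\<^sup>q\<close> and iterated, bounds \<open>\<integral>V|u|\<^bsup>p+1\<^esup>\<close> by a multiple of \<open>\<parallel>u\<parallel>\<^sub>V\<^sup>2\<close> on bounded sets; with the
  Nehari identity this keeps \<open>\<parallel>u\<^sub>n\<parallel>\<^sub>2\<close> away from zero. If the weak limit vanished, coercivity of \<open>V\<close>
  (smallness of \<open>u\<^sub>n\<close> far out) and comparison with averages over small balls (which tend to zero by weak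
  convergence) would force \<open>\<parallel>u\<^sub>n\<parallel>\<^sub>2 \<longlonglongrightarrow> 0\<close>, a contradiction.\<close>

section \<open>Square-integrable functions\<close>

text \<open>The nonlinear term is a product whose two factors play different parts: the weighted
  factor need only be bounded, while the plain L2 factor carries all the compactness. The bound on
  the weighted factor has to be linear in \<open>normV_sq\<close>, because only then can the norm be
  cancelled from the Nehari identity. The obstacle is that \<open>V\<close> is unbounded, so a
  Sobolev embedding without weight says nothing about the weighted factor. The condition on the
  gradient of \<open>V\<close> has the right scaling for this: the gradient of sqrt V is DV / (2
  sqrt V), of norm at most (C / 2) V, so differentiating sqrt V u^q produces another integral with
  the same weight \<open>V\<close> and no higher power of it. Weak limits are taken in the concrete
  space of square-integrable functions with values in R x R^2. There \<open>H1V\<close> appears as a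
  closed set through \<open>weighted_pair\<close>, and completeness, weak compactness and closedness
  can all be argued with integrals.\<close>

definition L2_space :: "'a measure \<Rightarrow> ('a \<Rightarrow> 'b::euclidean_space) set" where
  "L2_space M = {F. F \<in> borel_measurable M \<and> integrable M (\<lambda>x. (norm (F x))\<^sup>2)}"

definition L2_inner :: "'a measure \<Rightarrow> ('a \<Rightarrow> 'b::euclidean_space) \<Rightarrow> ('a \<Rightarrow> 'b) \<Rightarrow> real" where
  "L2_inner M F G = (\<integral>x. F x \<bullet> G x \<partial>M)"

lemma norm_add_sq_le:
  fixes a b :: "'a::real_inner"
  shows "(norm (a + b))\<^sup>2 \<le> 2 * (norm a)\<^sup>2 + 2 * (norm b)\<^sup>2"
proof -
  have "0 \<le> (norm (a - b))\<^sup>2" by simp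
  then show ?thesis
    by (simp add: power2_norm_eq_inner inner_simps inner_commute)
qed

lemma norm_diff_sq_le:
  fixes a b :: "'a::real_inner"
  shows "(norm (a - b))\<^sup>2 \<le> 2 * (norm (a - c))\<^sup>2 + 2 * (norm (c - b))\<^sup>2"
  using norm_add_sq_le[of "a - c" "c - b"] by simp

lemma L2_measurable: "F \<in> L2_space M \<Longrightarrow> F \<in> borel_measurable M"
  by (simp add: L2_space_def)

lemma L2_add:
  assumes "F \<in> L2_space M" "G \<in> L2_space M"
  shows "(\<lambda>x. F x + G x) \<in> L2_space M"
proof -
  have [measurable]: "F \<in> borel_measurable M" "G \<in> borel_measurable M"
    using assms by (auto simp: L2_space_def)
  have "integrable M (\<lambda>x. (norm (F x + G x))\<^sup>2)"
  proof (rule Bochner_Integration.integrable_bound)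
    show "integrable M (\<lambda>x. 2 * (norm (F x))\<^sup>2 + 2 * (norm (G x))\<^sup>2)"
      using assms by (auto simp: L2_space_def)
    show "AE x in M. norm ((norm (F x + G x))\<^sup>2) \<le> norm (2 * (norm (F x))\<^sup>2 + 2 * (norm (G x))\<^sup>2)"
      using norm_add_sq_le by (intro AE_I2) (auto simp: abs_of_nonneg)
  qed simp
  then show ?thesis by (simp add: L2_space_def)
qed

lemma L2_scale:
  assumes "F \<in> L2_space M"
  shows "(\<lambda>x. c *\<^sub>R F x) \<in> L2_space M"
  using assms by (auto simp: L2_space_def power_mult_distrib)

lemma L2_diff:
  assumes "F \<in> L2_space M" "G \<in> L2_space M"
  shows "(\<lambda>x. F x - G x) \<in> L2_space M"
  using L2_add[OF assms(1) L2_scale[OF assms(2), of "-1"]] by simp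

lemma L2_inner_integrable:
  assumes "F \<in> L2_space M" "G \<in> L2_space M"
  shows "integrable M (\<lambda>x. F x \<bullet> G x)"
proof (rule Bochner_Integration.integrable_bound)
  have [measurable]: "F \<in> borel_measurable M" "G \<in> borel_measurable M"
    using assms by (auto simp: L2_space_def)
  show "integrable M (\<lambda>x. (norm (F x))\<^sup>2 + (norm (G x))\<^sup>2)"
    using assms by (auto simp: L2_space_def)
  show "(\<lambda>x. F x \<bullet> G x) \<in> borel_measurable M" by simp
  show "AE x in M. norm (F x \<bullet> G x) \<le> norm ((norm (F x))\<^sup>2 + (norm (G x))\<^sup>2)"
  proof (rule AE_I2)
    fix x
    have "\<bar>F x \<bullet> G x\<bar> \<le> norm (F x) * norm (G x)" by (rule Cauchy_Schwarz_ineq2)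
    also have "\<dots> \<le> (norm (F x))\<^sup>2 + (norm (G x))\<^sup>2"
      using sum_squares_bound[of "norm (F x)" "norm (G x)"]
        mult_nonneg_nonneg[OF norm_ge_zero[of "F x"] norm_ge_zero[of "G x"]] by linarith
    finally show "norm (F x \<bullet> G x) \<le> norm ((norm (F x))\<^sup>2 + (norm (G x))\<^sup>2)" by simp
  qed
qed

lemma L2_inner_commute: "L2_inner M F G = L2_inner M G F"
  by (simp add: L2_inner_def inner_commute)

lemma L2_inner_self: "L2_inner M F F = (\<integral>x. (norm (F x))\<^sup>2 \<partial>M)"
  by (simp add: L2_inner_def power2_norm_eq_inner)

lemma L2_inner_self_nonneg: "0 \<le> L2_inner M F F"
  by (simp add: L2_inner_self)

lemma L2_inner_add_left:
  assumes "F \<in> L2_space M" "G \<in> L2_space M" "H \<in> L2_space M"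
  shows "L2_inner M (\<lambda>x. F x + G x) H = L2_inner M F H + L2_inner M G H"
  using assms by (simp add: L2_inner_def inner_add_left L2_inner_integrable)

lemma L2_inner_diff_left:
  assumes "F \<in> L2_space M" "G \<in> L2_space M" "H \<in> L2_space M"
  shows "L2_inner M (\<lambda>x. F x - G x) H = L2_inner M F H - L2_inner M G H"
  using assms by (simp add: L2_inner_def inner_diff_left L2_inner_integrable)

lemma L2_inner_scale_left: "L2_inner M (\<lambda>x. c *\<^sub>R F x) H = c * L2_inner M F H"
  by (simp add: L2_inner_def)

lemma L2_inner_add_right:
  assumes "F \<in> L2_space M" "G \<in> L2_space M" "H \<in> L2_space M"
  shows "L2_inner M H (\<lambda>x. F x + G x) = L2_inner M H F + L2_inner M H G"
  using assms by (simp add: L2_inner_def inner_add_right L2_inner_integrable)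

lemma L2_inner_diff_right:
  assumes "F \<in> L2_space M" "G \<in> L2_space M" "H \<in> L2_space M"
  shows "L2_inner M H (\<lambda>x. F x - G x) = L2_inner M H F - L2_inner M H G"
  using assms by (simp add: L2_inner_def inner_diff_right L2_inner_integrable)

lemma L2_inner_scale_right: "L2_inner M H (\<lambda>x. c *\<^sub>R F x) = c * L2_inner M H F"
  by (simp add: L2_inner_def)

lemmas L2_inner_simps = L2_inner_add_left L2_inner_diff_left L2_inner_scale_left
  L2_inner_add_right L2_inner_diff_right L2_inner_scale_right

text \<open>Functions are not identified almost everywhere, so \<open>L2_inner\<close> is only
  semidefinite, and the discriminant argument has to treat a second argument of norm zero
  separately.\<close>

lemma L2_Cauchy_Schwarz:
  assumes F: "F \<in> L2_space M" and G: "G \<in> L2_space M"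
  shows "(L2_inner M F G)\<^sup>2 \<le> L2_inner M F F * L2_inner M G G"
proof -
  let ?a = "L2_inner M F F" and ?b = "L2_inner M F G" and ?c = "L2_inner M G G"
  have quad: "0 \<le> ?a - 2 * t * ?b + t\<^sup>2 * ?c" for t
  proof -
    have "0 \<le> L2_inner M (\<lambda>x. F x - t *\<^sub>R G x) (\<lambda>x. F x - t *\<^sub>R G x)"
      by (rule L2_inner_self_nonneg)
    also have "\<dots> = ?a - 2 * t * ?b + t\<^sup>2 * ?c"
      using F G by (simp add: L2_inner_simps L2_diff L2_scale L2_inner_commute[of M G F]
          power2_eq_square algebra_simps)
    finally show ?thesis .
  qed
  show ?thesis
  proof (cases "?c = 0")
    case True
    have "?b = 0"
    proof (rule ccontr)
      assume b: "?b \<noteq> 0"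
      \<comment> \<open>With \<open>?c\<close> equal to 0 the quadratic is linear in
        \<open>t\<close>, and at this \<open>t\<close> its value is -1.\<close>
      have "0 \<le> ?a - 2 * ((?a + 1) / (2 * ?b)) * ?b" using quad[of "(?a + 1) / (2 * ?b)"] True by simp
      then show False using b by simp
    qed
    then show ?thesis using True by simp
  next
    case False
    then have c: "?c > 0" using L2_inner_self_nonneg[of M G] by linarith
    \<comment> \<open>\<open>?b / ?c\<close> is the minimiser of the quadratic; the factor
      \<open>?c\<close> clears the denominator.\<close>
    have "0 \<le> ?c * (?a - 2 * (?b / ?c) * ?b + (?b / ?c)\<^sup>2 * ?c)"
      using quad[of "?b / ?c"] c by simp
    also have "\<dots> = ?a * ?c - ?b\<^sup>2"
      using c by (simp add: field_simps power2_eq_square)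
    finally show ?thesis by simp
  qed
qed

text \<open>A triangle inequality for squared distances; the factors 2 are the price for avoiding
  square roots. With one function zero it bounds a squared norm by a distance and another squared
  norm.\<close>

lemma L2_inner_diff_self_le:
  assumes "F \<in> L2_space M" "G \<in> L2_space M" "H \<in> L2_space M"
  shows "L2_inner M (\<lambda>x. F x - G x) (\<lambda>x. F x - G x) \<le>
     2 * L2_inner M (\<lambda>x. F x - H x) (\<lambda>x. F x - H x) + 2 * L2_inner M (\<lambda>x. H x - G x) (\<lambda>x. H x - G x)"
proof -
  have *: "integrable M (\<lambda>x. (norm (F x - G x))\<^sup>2)" "integrable M (\<lambda>x. (norm (F x - H x))\<^sup>2)"
      "integrable M (\<lambda>x. (norm (H x - G x))\<^sup>2)"
    using L2_diff assms unfolding L2_space_def by blast+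
  have "(\<integral>x. (norm (F x - G x))\<^sup>2 \<partial>M) \<le> (\<integral>x. 2 * (norm (F x - H x))\<^sup>2 + 2 * (norm (H x - G x))\<^sup>2 \<partial>M)"
    using * by (intro integral_mono norm_diff_sq_le) auto
  then show ?thesis using * by (simp add: L2_inner_self)
qed

lemma nn_integral_L2:
  assumes "F \<in> L2_space M"
  shows "(\<integral>\<^sup>+x. ennreal ((norm (F x))\<^sup>2) \<partial>M) = ennreal (L2_inner M F F)"
  using assms by (simp add: L2_inner_self L2_space_def nn_integral_eq_integral)

lemma L2_I_nn_integral:
  assumes "F \<in> borel_measurable M" "(\<integral>\<^sup>+x. ennreal ((norm (F x))\<^sup>2) \<partial>M) < \<infinity>"
  shows "F \<in> L2_space M"
  using assms by (simp add: L2_space_def integrable_iff_bounded)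

text \<open>The squared distances tend to zero in L1, and L1 convergence gives convergence almost
  everywhere along a subsequence.\<close>

lemma L2_convergent_AE_subseq:
  assumes F: "\<And>n. F n \<in> L2_space M" and G: "G \<in> L2_space M"
    and conv: "(\<lambda>n. L2_inner M (\<lambda>x. F n x - G x) (\<lambda>x. F n x - G x)) \<longlonglongrightarrow> 0"
  obtains r :: "nat \<Rightarrow> nat" where "strict_mono r" "AE x in M. (\<lambda>n. F (r n) x) \<longlonglongrightarrow> G x"
proof -
  have "integrable M (\<lambda>x. (norm (F n x - G x))\<^sup>2)" for n
    using L2_diff[OF F G] by (simp add: L2_space_def)
  moreover have "(\<lambda>n. \<integral>x. norm ((norm (F n x - G x))\<^sup>2) \<partial>M) \<longlonglongrightarrow> 0"
    using conv by (simp add: L2_inner_self)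
  ultimately obtain r :: "nat \<Rightarrow> nat" where r: "strict_mono r"
      and ae: "AE x in M. (\<lambda>n. (norm (F (r n) x - G x))\<^sup>2) \<longlonglongrightarrow> 0"
    using tendsto_L1_AE_subseq[of M "\<lambda>n x. (norm (F n x - G x))\<^sup>2"] by blast
  have "AE x in M. (\<lambda>n. F (r n) x) \<longlonglongrightarrow> G x"
    using ae
  proof eventually_elim
    fix x assume "(\<lambda>n. (norm (F (r n) x - G x))\<^sup>2) \<longlonglongrightarrow> 0"
    from tendsto_real_sqrt[OF this] have "(\<lambda>n. norm (F (r n) x - G x)) \<longlonglongrightarrow> 0" by simp
    then have "(\<lambda>n. F (r n) x - G x) \<longlonglongrightarrow> 0" by (rule tendsto_norm_zero_cancel)
    then show "(\<lambda>n. F (r n) x) \<longlonglongrightarrow> G x" using Lim_null by blast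
  qed
  with r show thesis by (rule that)
qed

section \<open>Completeness of L2\<close>

lemma summable_norm_of_weighted_squares:
  fixes d :: "nat \<Rightarrow> 'a::banach"
  assumes "\<And>k. 2 ^ k * (norm (d k))\<^sup>2 \<le> B"
  shows "summable d"
proof (rule summable_norm_cancel, rule summable_comparison_test')
  \<comment> \<open>The weight 2^k forces decay like 2^(-k/2), hence this ratio.\<close>
  let ?q = "1 / sqrt 2 :: real"
  have "summable (\<lambda>k. ?q ^ k)" by (rule summable_geometric) simp
  then show "summable (\<lambda>k. sqrt B * ?q ^ k)" by (rule summable_mult)
  fix k :: nat
  have "(norm (d k))\<^sup>2 \<le> B / 2 ^ k" using assms[of k] by (simp add: field_simps)
  then have "norm (d k) \<le> sqrt (B / 2 ^ k)" by (simp add: real_le_rsqrt)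
  also have "\<dots> = sqrt B * ?q ^ k" by (simp add: real_sqrt_divide real_sqrt_power power_divide)
  finally show "norm (norm (d k)) \<le> sqrt B * ?q ^ k" by simp
qed

lemma ennreal_le_suminf:
  fixes f :: "nat \<Rightarrow> ennreal"
  shows "f k \<le> suminf f"
  using sum_le_suminf[OF summableI, of "{k}" f] by simp

text \<open>Fatou's lemma, in the form that also carries integral bounds from test functions over to
  elements of \<open>H1V\<close>.\<close>

lemma nn_integral_le_of_AE_limit:
  fixes f :: "nat \<Rightarrow> 'a \<Rightarrow> real"
  assumes [measurable]: "\<And>k. f k \<in> borel_measurable M"
    and conv: "AE x in M. (\<lambda>k. f k x) \<longlonglongrightarrow> g x"
    and le: "\<forall>\<^sub>F k in sequentially. (\<integral>\<^sup>+x. ennreal (f k x) \<partial>M) \<le> c"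
  shows "(\<integral>\<^sup>+x. ennreal (g x) \<partial>M) \<le> c"
proof -
  have "(\<integral>\<^sup>+x. ennreal (g x) \<partial>M) \<le> (\<integral>\<^sup>+x. liminf (\<lambda>k. ennreal (f k x)) \<partial>M)"
  proof (rule nn_integral_mono_AE)
    show "AE x in M. ennreal (g x) \<le> liminf (\<lambda>k. ennreal (f k x))"
      using conv by eventually_elim
        (simp add: lim_imp_Liminf[OF trivial_limit_sequentially tendsto_ennrealI])
  qed
  also have "\<dots> \<le> liminf (\<lambda>k. \<integral>\<^sup>+x. ennreal (f k x) \<partial>M)"
    by (rule nn_integral_liminf) simp
  also have "\<dots> \<le> c"
    by (rule Liminf_le[OF _ le]) simp
  finally show ?thesis .
qed

text \<open>Riesz-Fischer: along a fast subsequence the weighted squares of the increments have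
  finite integral, so the increments are summable almost everywhere; Fatou then turns the pointwise
  limit into a limit in norm.\<close>

lemma L2_complete:
  fixes F :: "nat \<Rightarrow> 'a \<Rightarrow> 'b::euclidean_space"
  assumes F: "\<And>n. F n \<in> L2_space M"
    and Cauchy: "\<And>e. e > 0 \<Longrightarrow> \<exists>N. \<forall>m\<ge>N. \<forall>n\<ge>N. L2_inner M (\<lambda>x. F m x - F n x) (\<lambda>x. F m x - F n x) < e"
  obtains G where "G \<in> L2_space M" "(\<lambda>n. L2_inner M (\<lambda>x. F n x - G x) (\<lambda>x. F n x - G x)) \<longlonglongrightarrow> 0"
proof -
  define n2 where "n2 m n = L2_inner M (\<lambda>x. F m x - F n x) (\<lambda>x. F m x - F n x)" for m n
  have Fm [measurable]: "F n \<in> borel_measurable M" for n using F by (rule L2_measurable)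
  \<comment> \<open>The rate (1/4)^k absorbs the weight 2^k put on the increments below and leaves
    the summable (1/2)^k.\<close>
  have "\<forall>k. \<exists>N. \<forall>m\<ge>N. \<forall>n\<ge>N. n2 m n < (1/4)^k"
    unfolding n2_def by (intro allI Cauchy) simp
  then obtain N where N: "\<And>k m n. m \<ge> N k \<Longrightarrow> n \<ge> N k \<Longrightarrow> n2 m n < (1/4)^k" by metis
  \<comment> \<open>The sum makes \<open>r\<close> monotone and puts \<open>r k\<close> beyond
    \<open>N k\<close>; the summand \<open>k\<close> gives \<open>k \<le> r k\<close>, so that
    \<open>r\<close> reaches every tail.\<close>
  define r where "r k = k + (\<Sum>i\<le>k. N i)" for k
  have rN: "r k \<ge> N k" for k unfolding r_def by (rule trans_le_add2, rule member_le_sum) auto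
  have r_mono: "r k \<le> r (Suc k)" for k by (simp add: r_def)
  have rr: "n2 (r (Suc k)) (r k) < (1/4)^k" for k
    using N[OF order.trans[OF rN r_mono] rN] .
  have rk: "n \<le> r k" if "n \<le> k" for n k using that by (simp add: r_def)
  define d where "d k x = F (r (Suc k)) x - F (r k) x" for k x
  have d: "d k \<in> L2_space M" for k unfolding d_def by (intro L2_diff F)
  have [measurable]: "d k \<in> borel_measurable M" for k using d by (rule L2_measurable)
  have "(\<integral>\<^sup>+x. (\<Sum>k. ennreal (2 ^ k * (norm (d k x))\<^sup>2)) \<partial>M)
      = (\<Sum>k. \<integral>\<^sup>+x. ennreal (2 ^ k * (norm (d k x))\<^sup>2) \<partial>M)"
    by (rule nn_integral_suminf) simp
  also have "\<dots> = (\<Sum>k. ennreal (2 ^ k * n2 (r (Suc k)) (r k)))"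
    using nn_integral_L2[OF d] by (simp add: ennreal_mult nn_integral_cmult n2_def d_def[abs_def] L2_inner_self_nonneg)
  also have "\<dots> \<le> (\<Sum>k. ennreal ((1/2) ^ k))"
  proof (intro suminf_le summableI ennreal_leI)
    fix k :: nat
    have "2 ^ k * n2 (r (Suc k)) (r k) \<le> 2 ^ k * (1/4) ^ k"
      using rr[of k] by (intro mult_left_mono) auto
    also have "\<dots> = (1/2) ^ k" by (simp flip: power_mult_distrib)
    finally show "2 ^ k * n2 (r (Suc k)) (r k) \<le> (1/2) ^ k" .
  qed
  also have "\<dots> = ennreal (\<Sum>k. (1/2) ^ k)"
    by (rule suminf_ennreal2) (auto intro: summable_geometric)
  finally have fin: "(\<integral>\<^sup>+x. (\<Sum>k. ennreal (2 ^ k * (norm (d k x))\<^sup>2)) \<partial>M) \<noteq> \<infinity>"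
    by (auto simp: top_unique)
  \<comment> \<open>\<open>lim\<close> is total, so \<open>G\<close> is a measurable function on the
    whole space; it is the true limit wherever the subsequence converges.\<close>
  define G where "G x = lim (\<lambda>k. F (r k) x)" for x
  have [measurable]: "G \<in> borel_measurable M" unfolding G_def by measurable
  have "AE x in M. (\<Sum>k. ennreal (2 ^ k * (norm (d k x))\<^sup>2)) \<noteq> \<infinity>"
    using fin by (rule nn_integral_PInf_AE[rotated]) measurable
  then have conv: "AE x in M. (\<lambda>k. F (r k) x) \<longlonglongrightarrow> G x"
  proof eventually_elim
    case (elim x)
    let ?S = "\<Sum>k. ennreal (2 ^ k * (norm (d k x))\<^sup>2)"
    define B where "B = enn2real ?S"
    have B: "?S = ennreal B" "B \<ge> 0"
      using elim unfolding B_def by (auto simp only: ennreal_enn2real less_top enn2real_nonneg infinity_ennreal_def)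
    have "ennreal (2 ^ k * (norm (d k x))\<^sup>2) \<le> ?S" for k
      by (rule ennreal_le_suminf)
    then have "2 ^ k * (norm (d k x))\<^sup>2 \<le> B" for k by (simp only: B(1) ennreal_le_iff[OF B(2)])
    then have "summable (\<lambda>k. d k x)" by (rule summable_norm_of_weighted_squares)
    then have "(\<lambda>n. \<Sum>k<n. d k x) \<longlonglongrightarrow> (\<Sum>k. d k x)" by (rule summable_LIMSEQ)
    then have "(\<lambda>n. (\<Sum>k<n. d k x) + F (r 0) x) \<longlonglongrightarrow> (\<Sum>k. d k x) + F (r 0) x"
      by (intro tendsto_intros)
    moreover have "(\<Sum>k<n. d k x) + F (r 0) x = F (r n) x" for n
      unfolding d_def by (induct n) (auto simp: algebra_simps)
    ultimately have "convergent (\<lambda>n. F (r n) x)" by (auto simp: convergent_def)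
    then show ?case unfolding G_def by (simp add: convergent_LIMSEQ_iff)
  qed
  have le: "(\<integral>\<^sup>+x. ennreal ((norm (F n x - G x))\<^sup>2) \<partial>M) \<le> ennreal e"
    if n: "\<And>m. m \<ge> n \<Longrightarrow> n2 n m \<le> e" for n e
  proof -
    have "AE x in M. (\<lambda>k. (norm (F n x - F (r k) x))\<^sup>2) \<longlonglongrightarrow> (norm (F n x - G x))\<^sup>2"
      using conv by eventually_elim (intro tendsto_intros)
    moreover have "\<forall>\<^sub>F k in sequentially. (\<integral>\<^sup>+x. ennreal ((norm (F n x - F (r k) x))\<^sup>2) \<partial>M) \<le> ennreal e"
      unfolding eventually_sequentially nn_integral_L2[OF L2_diff[OF F F]]
      using n rk by (auto intro!: exI[of _ n] ennreal_leI simp: n2_def)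
    ultimately show ?thesis by (rule nn_integral_le_of_AE_limit[rotated]) measurable
  qed
  have ev: "\<exists>n0. \<forall>n\<ge>n0. (\<integral>\<^sup>+x. ennreal ((norm (F n x - G x))\<^sup>2) \<partial>M) \<le> ennreal e" if "e > 0" for e
  proof -
    obtain n0 where n0: "\<And>m n. m \<ge> n0 \<Longrightarrow> n \<ge> n0 \<Longrightarrow> n2 m n < e"
      using Cauchy[OF \<open>e > 0\<close>] by (auto simp: n2_def)
    have "(\<integral>\<^sup>+x. ennreal ((norm (F n x - G x))\<^sup>2) \<partial>M) \<le> ennreal e" if "n \<ge> n0" for n
      using that by (intro le order.strict_implies_order[OF n0]) auto
    then show ?thesis by blast
  qed
  have G: "G \<in> L2_space M"
  proof -
    obtain n0 where "(\<integral>\<^sup>+x. ennreal ((norm (F n0 x - G x))\<^sup>2) \<partial>M) \<le> ennreal 1" using ev[of 1] by auto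
    then have "(\<lambda>x. F n0 x - G x) \<in> L2_space M"
      by (intro L2_I_nn_integral) (auto intro: le_less_trans)
    from L2_diff[OF F[of n0] this] show ?thesis by simp
  qed
  moreover have "(\<lambda>n. L2_inner M (\<lambda>x. F n x - G x) (\<lambda>x. F n x - G x)) \<longlonglongrightarrow> 0"
  proof (rule LIMSEQ_I)
    fix e :: real assume "e > 0"
    then obtain n0 where n0: "\<And>n. n \<ge> n0 \<Longrightarrow>
        (\<integral>\<^sup>+x. ennreal ((norm (F n x - G x))\<^sup>2) \<partial>M) \<le> ennreal (e/2)"
      using ev[of "e/2"] by auto
    have "norm (L2_inner M (\<lambda>x. F n x - G x) (\<lambda>x. F n x - G x) - 0) < e" if "n \<ge> n0" for n
      using n0[OF that] \<open>e > 0\<close> L2_inner_self_nonneg[of M "\<lambda>x. F n x - G x"]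
      by (simp add: nn_integral_L2[OF L2_diff[OF F G]])
    then show "\<exists>n0. \<forall>n\<ge>n0. norm (L2_inner M (\<lambda>x. F n x - G x) (\<lambda>x. F n x - G x) - 0) < e" by blast
  qed
  ultimately show thesis by (rule that)
qed

lemma L2_Cauchy_Schwarz_abs:
  assumes "F \<in> L2_space M" "G \<in> L2_space M"
  shows "\<bar>L2_inner M F G\<bar> \<le> sqrt (L2_inner M F F * L2_inner M G G)"
  using real_le_rsqrt[of "\<bar>L2_inner M F G\<bar>"] L2_Cauchy_Schwarz[OF assms] by simp

lemma L2_inner_tendsto:
  assumes S: "\<And>n. S n \<in> L2_space M" and G: "G \<in> L2_space M" and w: "w \<in> L2_space M"
    and conv: "(\<lambda>n. L2_inner M (\<lambda>x. S n x - G x) (\<lambda>x. S n x - G x)) \<longlonglongrightarrow> 0"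
  shows "(\<lambda>n. L2_inner M (S n) w) \<longlonglongrightarrow> L2_inner M G w"
proof -
  have "(\<lambda>n. sqrt (L2_inner M (\<lambda>x. S n x - G x) (\<lambda>x. S n x - G x) * L2_inner M w w)) \<longlonglongrightarrow> sqrt (0 * L2_inner M w w)"
    by (intro tendsto_intros conv)
  then have lim: "(\<lambda>n. sqrt (L2_inner M (\<lambda>x. S n x - G x) (\<lambda>x. S n x - G x) * L2_inner M w w)) \<longlonglongrightarrow> 0" by simp
  have "(\<lambda>n. L2_inner M (S n) w - L2_inner M G w) \<longlonglongrightarrow> 0"
  proof (rule Lim_null_comparison[OF always_eventually lim], rule allI)
    fix n
    show "norm (L2_inner M (S n) w - L2_inner M G w)
        \<le> sqrt (L2_inner M (\<lambda>x. S n x - G x) (\<lambda>x. S n x - G x) * L2_inner M w w)"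
      using L2_Cauchy_Schwarz_abs[OF L2_diff[OF S[of n] G] w] S G w by (simp add: L2_inner_diff_left)
  qed
  then show ?thesis using Lim_null by blast
qed

section \<open>Weak sequential compactness of bounded sequences in L2\<close>

text \<open>If \<open>\<langle>z\<^sub>n, w\<rangle>\<close> did not tend to zero, signed sums of \<open>N\<close> almost orthogonal members of the sequence
  would have norm of order \<open>\<surd>N\<close> but inner product with \<open>w\<close> of order \<open>N\<close>.\<close>

lemma L2_weakly_null_if_asymptotically_orthogonal:
  assumes z: "\<And>n. z n \<in> L2_space M" and w: "w \<in> L2_space M"
    and bound: "\<And>n. L2_inner M (z n) (z n) \<le> K"
    and orth: "\<And>k. (\<lambda>n. L2_inner M (z n) (z k)) \<longlonglongrightarrow> 0"
  shows "(\<lambda>n. L2_inner M (z n) w) \<longlonglongrightarrow> 0"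
proof (rule ccontr)
  assume "\<not> ?thesis"
  then obtain e where e: "e > 0" and freq: "\<And>N. \<exists>n\<ge>N. e \<le> \<bar>L2_inner M (z n) w\<bar>"
    unfolding LIMSEQ_def dist_real_def by (auto simp: not_less)
  \<comment> \<open>Each new term costs at most \<open>K\<close> for its own square and 2 for the
    doubled cross term, hence \<open>K + 2\<close> per step. The null limit against \<open>G\<close>
    is carried along so that the next term can again be chosen almost orthogonal to
    \<open>G\<close>.\<close>
  have claim: "\<exists>G\<in>L2_space M. (\<lambda>n. L2_inner M (z n) G) \<longlonglongrightarrow> 0
      \<and> L2_inner M G G \<le> real N * (K + 2) \<and> real N * e \<le> L2_inner M G w" for N
  proof (induct N)
    case 0
    show ?case by (rule bexI[of _ "\<lambda>_. 0"]) (auto simp: L2_space_def L2_inner_def)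
  next
    case (Suc N)
    then obtain G where G: "G \<in> L2_space M" and lim: "(\<lambda>n. L2_inner M (z n) G) \<longlonglongrightarrow> 0"
      and G2: "L2_inner M G G \<le> real N * (K + 2)" and Gw: "real N * e \<le> L2_inner M G w" by blast
    obtain n0 where n0: "\<And>n. n \<ge> n0 \<Longrightarrow> \<bar>L2_inner M (z n) G\<bar> < 1"
      using LIMSEQ_D[OF lim, of 1] by auto
    obtain n where n: "n \<ge> n0" "e \<le> \<bar>L2_inner M (z n) w\<bar>" using freq by blast
    \<comment> \<open>The sign makes the contribution of the new term to the pairing with
      \<open>w\<close> positive, so that gains of at least \<open>e\<close> add up.\<close>
    define s where "s = sgn (L2_inner M (z n) w)"
    have s: "s * s = 1" "s * L2_inner M (z n) w = \<bar>L2_inner M (z n) w\<bar>" "\<bar>s\<bar> = 1"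
      using n e by (auto simp: s_def sgn_if)
    let ?G = "\<lambda>x. G x + s *\<^sub>R z n x"
    have "(\<lambda>m. L2_inner M (z m) G + s * L2_inner M (z m) (z n)) \<longlonglongrightarrow> 0 + s * 0"
      by (intro tendsto_intros lim orth)
    then have 1: "(\<lambda>m. L2_inner M (z m) ?G) \<longlonglongrightarrow> 0"
      using z G by (simp add: L2_inner_simps L2_scale)
    have "L2_inner M ?G ?G = L2_inner M G G + 2 * (s * L2_inner M (z n) G) + s * s * L2_inner M (z n) (z n)"
      using z G by (simp add: L2_inner_simps L2_scale L2_add L2_inner_commute[of M G "z n"] algebra_simps)
    also have "\<dots> \<le> real N * (K + 2) + 2 * 1 + K"
    proof -
      have "s * L2_inner M (z n) G \<le> \<bar>s * L2_inner M (z n) G\<bar>" by simp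
      also have "\<dots> \<le> 1" using n0[OF n(1)] s(3) by (simp add: abs_mult)
      finally show ?thesis using G2 bound[of n] s(1) by simp
    qed
    finally have 2: "L2_inner M ?G ?G \<le> real (Suc N) * (K + 2)" by (simp add: algebra_simps)
    have "L2_inner M ?G w = L2_inner M G w + \<bar>L2_inner M (z n) w\<bar>"
      using z G w s(2) by (simp add: L2_inner_simps L2_scale)
    then have 3: "real (Suc N) * e \<le> L2_inner M ?G w" using Gw n(2) by (simp add: algebra_simps)
    show ?case using 1 2 3 L2_add[OF G L2_scale[OF z]] by blast
  qed
  have K: "K \<ge> 0" using bound[of 0] L2_inner_self_nonneg order.trans by blast
  \<comment> \<open>For such \<open>N\<close> the lower bound (N e)^2 exceeds the Cauchy-Schwarz
    bound, which grows only linearly in \<open>N\<close>.\<close>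
  obtain N :: nat where N: "real N > (K + 2) * L2_inner M w w / (e * e)" using reals_Archimedean2 by blast
  have Npos: "real N > 0" using N K e L2_inner_self_nonneg[of M w]
    by (smt (verit) divide_nonneg_nonneg mult_nonneg_nonneg)
  obtain G where G: "G \<in> L2_space M" and G2: "L2_inner M G G \<le> real N * (K + 2)"
    and Gw: "real N * e \<le> L2_inner M G w" using claim by blast
  have "(real N * e)\<^sup>2 \<le> (L2_inner M G w)\<^sup>2" using Gw e by (intro power_mono) auto
  also have "\<dots> \<le> L2_inner M G G * L2_inner M w w" by (rule L2_Cauchy_Schwarz[OF G w])
  also have "\<dots> \<le> real N * (K + 2) * L2_inner M w w"
    by (intro mult_right_mono G2 L2_inner_self_nonneg)
  finally have "real N * (real N * (e * e)) \<le> real N * ((K + 2) * L2_inner M w w)"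
    by (simp add: power2_eq_square algebra_simps)
  then have "real N * (e * e) \<le> (K + 2) * L2_inner M w w" using Npos by simp
  then show False using N e by (simp add: field_simps)
qed

text \<open>Midpoints suffice in place of all convex combinations, since the parallelogram law
  compares two elements only with their midpoint.\<close>

inductive_set midpoint_hull :: "('a \<Rightarrow> 'b::real_vector) set \<Rightarrow> ('a \<Rightarrow> 'b) set" for S where
  base: "F \<in> S \<Longrightarrow> F \<in> midpoint_hull S"
| mid: "F \<in> midpoint_hull S \<Longrightarrow> G \<in> midpoint_hull S \<Longrightarrow> (\<lambda>x. (1/2) *\<^sub>R (F x + G x)) \<in> midpoint_hull S"

lemma midpoint_hull_mono:
  assumes "S \<subseteq> T"
  shows "midpoint_hull S \<subseteq> midpoint_hull T"
proof
  fix F assume "F \<in> midpoint_hull S"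
  then show "F \<in> midpoint_hull T"
    by induct (use assms in \<open>auto intro: midpoint_hull.intros\<close>)
qed

text \<open>Solved for the distance: two elements of squared norm near an infimum, whose midpoint
  does not lie below that infimum, must be close to each other.\<close>

lemma L2_parallelogram:
  assumes F: "F \<in> L2_space M" and G: "G \<in> L2_space M"
  shows "L2_inner M (\<lambda>x. F x - G x) (\<lambda>x. F x - G x) = 2 * L2_inner M F F + 2 * L2_inner M G G
    - 4 * L2_inner M (\<lambda>x. (1/2) *\<^sub>R (F x + G x)) (\<lambda>x. (1/2) *\<^sub>R (F x + G x))"
  using F G by (simp add: L2_inner_scale_left L2_inner_scale_right del: scaleR_add_right)
    (simp add: L2_inner_simps L2_add L2_diff L2_inner_commute[of M G F] algebra_simps)

lemma L2_midpoint_le: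
  assumes F: "F \<in> L2_space M" and G: "G \<in> L2_space M"
  shows "L2_inner M (\<lambda>x. (1/2) *\<^sub>R (F x + G x)) (\<lambda>x. (1/2) *\<^sub>R (F x + G x))
    \<le> (2 * L2_inner M F F + 2 * L2_inner M G G) / 4"
proof -
  have "0 \<le> L2_inner M (\<lambda>x. F x - G x) (\<lambda>x. F x - G x)" by (rule L2_inner_self_nonneg)
  then have "4 * L2_inner M (\<lambda>x. (1/2) *\<^sub>R (F x + G x)) (\<lambda>x. (1/2) *\<^sub>R (F x + G x))
      \<le> 2 * L2_inner M F F + 2 * L2_inner M G G"
    unfolding L2_parallelogram[OF assms] by (simp only: diff_ge_0_iff_ge)
  then show ?thesis by (simp only: le_divide_eq_numeral1 mult.commute)
qed

text \<open>The weak limit is obtained as the strong limit of elements of almost minimal norm in the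
  midpoint hulls of the tails, so it stays in every closed midpoint-convex set.\<close>

theorem L2_weakly_sequentially_compact:
  fixes F :: "nat \<Rightarrow> 'a \<Rightarrow> 'b::euclidean_space"
  assumes HL: "H \<subseteq> L2_space M"
    and H_mid: "\<And>A B. A \<in> H \<Longrightarrow> B \<in> H \<Longrightarrow> (\<lambda>x. (1/2) *\<^sub>R (A x + B x)) \<in> H"
    and H_closed: "\<And>S G. (\<And>n. S n \<in> H) \<Longrightarrow> G \<in> L2_space M \<Longrightarrow>
        (\<lambda>n. L2_inner M (\<lambda>x. S n x - G x) (\<lambda>x. S n x - G x)) \<longlonglongrightarrow> 0 \<Longrightarrow> G \<in> H"
    and FH: "\<And>n. F n \<in> H" and bound: "\<And>n. L2_inner M (F n) (F n) \<le> K"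
  obtains r Y where "strict_mono (r :: nat \<Rightarrow> nat)" "Y \<in> H"
    "\<And>w. w \<in> L2_space M \<Longrightarrow> (\<lambda>n. L2_inner M (F (r n)) w) \<longlonglongrightarrow> L2_inner M Y w"
proof -
  have F: "F n \<in> L2_space M" for n using FH HL by blast
  have K: "K \<ge> 0" using bound[of 0] L2_inner_self_nonneg order.trans by blast
  have bd: "norm (L2_inner M (F n) (F k)) \<le> K" for n k
  proof -
    have "\<bar>L2_inner M (F n) (F k)\<bar> \<le> sqrt (L2_inner M (F n) (F n) * L2_inner M (F k) (F k))"
      by (rule L2_Cauchy_Schwarz_abs[OF F F])
    also have "\<dots> \<le> sqrt (K * K)"
      by (intro real_sqrt_le_mono mult_mono bound K L2_inner_self_nonneg)
    finally show ?thesis using K by simp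
  qed
  \<comment> \<open>All pairings of the sequence with its own members are bounded by
    \<open>K\<close>, so one diagonal subsequence makes every one of them converge.\<close>
  obtain r where r: "strict_mono (r :: nat \<Rightarrow> nat)"
      and "\<And>k. k \<in> UNIV \<Longrightarrow> \<exists>l. (\<lambda>n. L2_inner M (F (r n)) (F k)) \<longlonglongrightarrow> l"
    by (rule function_convergent_subsequence[of "UNIV :: nat set" "\<lambda>n k. L2_inner M (F n) (F k)" K])
      (use bd in auto)
  then obtain a where a: "\<And>k. (\<lambda>n. L2_inner M (F (r n)) (F k)) \<longlonglongrightarrow> a k" by (metis UNIV_I)
  define C where "C n = midpoint_hull ((\<lambda>m. F (r m)) ` {n..})" for n
  have C_anti: "C m \<subseteq> C n" if "n \<le> m" for m n
    unfolding C_def using that by (intro midpoint_hull_mono image_mono) auto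
  have CH: "G \<in> H" if "G \<in> C n" for G n
    using that unfolding C_def by induct (auto intro: FH H_mid)
  have CL: "G \<in> L2_space M" if "G \<in> C n" for G n using CH[OF that] HL by blast
  define N where "N G = L2_inner M G G" for G :: "'a \<Rightarrow> 'b"
  \<comment> \<open>The infimum of the squared norm over a tail hull grows as the tail shrinks and
    stays below \<open>K\<close>; so \<open>d\<close> converges, which makes near-minimisers a
    Cauchy sequence.\<close>
  define d where "d n = Inf (N ` C n)" for n
  have FC: "F (r n) \<in> C n" for n unfolding C_def by (rule midpoint_hull.base) auto
  have bdd: "bdd_below (N ` C n)" for n
    by (rule bdd_belowI[of _ 0]) (auto simp: N_def L2_inner_self_nonneg)
  have d_le: "d n \<le> N G" if "G \<in> C n" for n G
    unfolding d_def using that by (intro cInf_lower bdd) auto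
  have C_ne: "N ` C n \<noteq> {}" for n using FC[of n] by blast
  have "incseq d"
    unfolding incseq_def d_def by (intro allI impI cInf_superset_mono image_mono C_anti C_ne bdd)
  moreover have "d n \<le> K" for n using d_le[OF FC] bound by (auto simp: N_def intro: order.trans)
  ultimately obtain l where "d \<longlonglongrightarrow> l" using incseq_convergent[of d K] by blast
  then have d_Cauchy: "Cauchy d" by (rule LIMSEQ_imp_Cauchy)
  have "\<exists>G\<in>C n. N G < d n + 1 / real (Suc n)" for n
  proof -
    have "Inf (N ` C n) < d n + 1 / real (Suc n)" by (simp add: d_def)
    then show ?thesis using cInf_lessD[of "N ` C n"] FC by blast
  qed
  then obtain y where yC: "\<And>n. y n \<in> C n" and yN: "\<And>n. N (y n) < d n + 1 / real (Suc n)" by metis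
  have yL: "y n \<in> L2_space M" for n using CL[OF yC] .
  have y_le: "N (\<lambda>x. y m x - y n x) \<le> 2 * \<bar>d m - d n\<bar> + 4 / real (Suc j)"
    if "j \<le> m" "j \<le> n" for m n j
  proof -
    \<comment> \<open>Both elements lie in the hull of the earlier tail, so their midpoint has
      squared norm at least \<open>d i\<close>. Since \<open>i\<close> is one of the two indices,
      \<open>d i\<close> can be traded for \<open>d m\<close> or \<open>d n\<close>.\<close>
    define i where "i = min m n"
    have C: "y m \<in> C i" "y n \<in> C i" using yC[of m] yC[of n] C_anti[of i m] C_anti[of i n] by (auto simp: i_def)
    have "(\<lambda>x. (1/2) *\<^sub>R (y m x + y n x)) \<in> C i"
      using C unfolding C_def by (rule midpoint_hull.mid)
    then have "d i \<le> N (\<lambda>x. (1/2) *\<^sub>R (y m x + y n x))" by (rule d_le)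
    moreover have "N (\<lambda>x. y m x - y n x) = 2 * N (y m) + 2 * N (y n) - 4 * N (\<lambda>x. (1/2) *\<^sub>R (y m x + y n x))"
      unfolding N_def by (rule L2_parallelogram[OF yL yL])
    ultimately have "N (\<lambda>x. y m x - y n x) \<le> 2 * N (y m) + 2 * N (y n) - 4 * d i" by simp
    moreover define q where "q k = 1 / real (Suc k)" for k
    moreover have "q m \<le> q j" "q n \<le> q j"
      using that by (auto simp: q_def intro!: divide_left_mono)
    moreover have "d i = d m \<or> d i = d n" by (auto simp: i_def min_def)
    moreover have "4 / real (Suc j) = 4 * q j" by (simp add: q_def)
    moreover have "N (y m) < d m + q m" "N (y n) < d n + q n" using yN by (auto simp: q_def)
    ultimately show ?thesis by argo
  qed
  have "\<exists>j. \<forall>m\<ge>j. \<forall>n\<ge>j. N (\<lambda>x. y m x - y n x) < e" if e: "e > 0" for e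
  proof -
    \<comment> \<open>One half of \<open>e\<close> is for the term with \<open>d\<close>, the other
      for the slack 4 / (j + 1) of the near-minimisers.\<close>
    obtain j1 where j1: "\<And>m n. m \<ge> j1 \<Longrightarrow> n \<ge> j1 \<Longrightarrow> \<bar>d m - d n\<bar> < e / 4"
      using metric_CauchyD[OF d_Cauchy, of "e/4"] e by (auto simp: dist_real_def)
    obtain j2 :: nat where j2: "8 / e < real j2" using reals_Archimedean2 by blast
    have "4 / real (Suc (max j1 j2)) < e / 2"
    proof -
      have "8 / e < real (Suc (max j1 j2))" using j2 by linarith
      then show ?thesis using e by (simp add: field_simps)
    qed
    then have "N (\<lambda>x. y m x - y n x) < e" if "m \<ge> max j1 j2" "n \<ge> max j1 j2" for m n
      using y_le[OF that] j1[of m n] that by simp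
    then show ?thesis by blast
  qed
  then obtain Y where YL: "Y \<in> L2_space M"
      and yY: "(\<lambda>n. L2_inner M (\<lambda>x. y n x - Y x) (\<lambda>x. y n x - Y x)) \<longlonglongrightarrow> 0"
    unfolding N_def using L2_complete[of y M, OF yL] by blast
  have YH: "Y \<in> H" by (rule H_closed[of y, OF CH[OF yC] YL yY])
  \<comment> \<open>\<open>y n\<close> lies in the hull of the tail from \<open>n\<close> on.
    Members of that tail pair with \<open>F k\<close> to within \<open>e\<close> of
    \<open>a k\<close> once \<open>n\<close> is large, and taking midpoints keeps this.\<close>
  have aY: "a k = L2_inner M Y (F k)" for k
  proof (rule LIMSEQ_unique)
    show "(\<lambda>n. L2_inner M (y n) (F k)) \<longlonglongrightarrow> L2_inner M Y (F k)"
      by (rule L2_inner_tendsto[OF yL YL F yY])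
    show "(\<lambda>n. L2_inner M (y n) (F k)) \<longlonglongrightarrow> a k"
    proof (rule LIMSEQ_I)
      fix e :: real assume "e > 0"
      then obtain n0 where n0: "\<And>n. n \<ge> n0 \<Longrightarrow> \<bar>L2_inner M (F (r n)) (F k) - a k\<bar> < e"
        using LIMSEQ_D[OF a[of k]] by (metis real_norm_def)
      have "\<bar>L2_inner M G (F k) - a k\<bar> < e" if "G \<in> C n" "n \<ge> n0" for G n
        using that(1) unfolding C_def
      proof induct
        case (base G)
        then show ?case using n0 that(2) by auto
      next
        case (mid A B)
        have AB: "A \<in> L2_space M" "B \<in> L2_space M" using mid(1,3) CL unfolding C_def by blast+
        have "L2_inner M (\<lambda>x. (1/2) *\<^sub>R (A x + B x)) (F k) = (L2_inner M A (F k) + L2_inner M B (F k)) / 2"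
          using AB F by (simp add: L2_inner_scale_left L2_inner_add_left del: scaleR_add_right)
        then show ?case using mid(2,4) by argo
      qed
      then show "\<exists>n0. \<forall>n\<ge>n0. norm (L2_inner M (y n) (F k) - a k) < e" using yC by (metis real_norm_def)
    qed
  qed
  define z where "z n x = F (r n) x - Y x" for n x
  have z: "z n \<in> L2_space M" for n unfolding z_def by (intro L2_diff F YL)
  have z_inner: "L2_inner M (z n) w = L2_inner M (F (r n)) w - L2_inner M Y w" if "w \<in> L2_space M" for n w
    unfolding z_def using that F YL by (rule L2_inner_diff_left[rotated 2])
  define K' where "K' = 2 * K + 2 * N Y"
  have zK: "L2_inner M (z n) (z n) \<le> K'" for n
  proof -
    have "L2_inner M (z n) (z n) \<le> 2 * L2_inner M (F (r n)) (F (r n)) + 2 * N Y"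
      using L2_inner_diff_self_le[OF F[of "r n"] YL, of "\<lambda>_. 0"]
      by (simp add: z_def[abs_def] N_def L2_space_def L2_inner_def)
    then show ?thesis using bound[of "r n"] by (simp add: K'_def)
  qed
  have zF: "(\<lambda>n. L2_inner M (z n) (F k)) \<longlonglongrightarrow> 0" for k
    using a[of k] unfolding z_inner[OF F] aY by (rule LIM_zero)
  have zC: "(\<lambda>n. L2_inner M (z n) G) \<longlonglongrightarrow> 0" if "G \<in> C m" for G m
    using that unfolding C_def
  proof induct
    case (base G)
    then show ?case using zF by auto
  next
    case (mid A B)
    have AB: "A \<in> L2_space M" "B \<in> L2_space M" using mid(1,3) CL unfolding C_def by blast+
    have "(\<lambda>n. (1/2) * (L2_inner M (z n) A + L2_inner M (z n) B)) \<longlonglongrightarrow> (1/2) * (0 + 0)"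
      by (intro tendsto_intros mid)
    then show ?case
      using AB z by (simp add: L2_inner_scale_right L2_inner_add_right del: scaleR_add_right)
  qed
  \<comment> \<open>\<open>Y\<close> need not lie in any hull, so it is replaced by a nearby
    \<open>y m\<close>; the bound \<open>K'\<close> makes the error uniform in
    \<open>n\<close>.\<close>
  have zY: "(\<lambda>n. L2_inner M (z n) Y) \<longlonglongrightarrow> 0"
  proof (rule LIMSEQ_I)
    fix e :: real assume e: "e > 0"
    have "(\<lambda>m. sqrt (K' * L2_inner M (\<lambda>x. y m x - Y x) (\<lambda>x. y m x - Y x))) \<longlonglongrightarrow> sqrt (K' * 0)"
      by (intro tendsto_intros yY)
    then have "\<forall>\<^sub>F m in sequentially. sqrt (K' * L2_inner M (\<lambda>x. y m x - Y x) (\<lambda>x. y m x - Y x)) < e/2"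
      by (rule order_tendstoD(2)) (use e in simp)
    then obtain m where
      m: "sqrt (K' * L2_inner M (\<lambda>x. y m x - Y x) (\<lambda>x. y m x - Y x)) < e/2"
      using eventually_happens'[OF sequentially_bot] by blast
    obtain n0 where n0: "\<And>n. n \<ge> n0 \<Longrightarrow> \<bar>L2_inner M (z n) (y m)\<bar> < e/2"
      using LIMSEQ_D[OF zC[OF yC[of m]], of "e/2"] e by auto
    have "norm (L2_inner M (z n) Y - 0) < e" if "n \<ge> n0" for n
    proof -
      have "\<bar>L2_inner M (z n) (\<lambda>x. y m x - Y x)\<bar>
          \<le> sqrt (L2_inner M (z n) (z n) * L2_inner M (\<lambda>x. y m x - Y x) (\<lambda>x. y m x - Y x))"
        by (rule L2_Cauchy_Schwarz_abs[OF z L2_diff[OF yL YL]])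
      also have "\<dots> \<le> sqrt (K' * L2_inner M (\<lambda>x. y m x - Y x) (\<lambda>x. y m x - Y x))"
        by (intro real_sqrt_le_mono mult_right_mono zK L2_inner_self_nonneg)
      finally have "\<bar>L2_inner M (z n) (y m) - L2_inner M (z n) Y\<bar> < e/2"
        using m L2_inner_diff_right[OF yL YL z] by auto
      then show ?thesis using n0[OF that] unfolding real_norm_def diff_zero by linarith
    qed
    then show "\<exists>n0. \<forall>n\<ge>n0. norm (L2_inner M (z n) Y - 0) < e" by blast
  qed
  \<comment> \<open>Expanding the second argument leaves pairings with a fixed member of the
    sequence and with \<open>Y\<close>, both already known to vanish in the limit.\<close>
  have orth: "(\<lambda>n. L2_inner M (z n) (z k)) \<longlonglongrightarrow> 0" for k
  proof -
    have "L2_inner M (z n) (z k) = L2_inner M (z n) (F (r k)) - L2_inner M (z n) Y" for n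
      unfolding z_def[of k, abs_def] by (rule L2_inner_diff_right[OF F YL z])
    then show ?thesis using tendsto_diff[OF zF[of "r k"] zY] by simp
  qed
  have "(\<lambda>n. L2_inner M (F (r n)) w) \<longlonglongrightarrow> L2_inner M Y w" if "w \<in> L2_space M" for w
    using L2_weakly_null_if_asymptotically_orthogonal[OF z that zK orth]
    unfolding z_inner[OF that] by (rule LIM_zero_cancel)
  with r YH show thesis by (rule that)
qed

section \<open>Test functions and the weighted Sobolev space\<close>

lemma Ck_lincomb: "f \<in> Ck k \<Longrightarrow> g \<in> Ck k \<Longrightarrow> (\<lambda>x. a * f x + b * g x) \<in> Ck k"
proof (induct k arbitrary: f g)
  case 0
  then show ?case by (auto intro!: continuous_intros)
next
  case (Suc k)
  obtain Df where Df: "\<And>x. (f has_derivative (\<lambda>h. Df x \<bullet> h)) (at x)" "\<And>i. (\<lambda>x. Df x $ i) \<in> Ck k"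
    using Suc.prems by auto
  obtain Dg where Dg: "\<And>x. (g has_derivative (\<lambda>h. Dg x \<bullet> h)) (at x)" "\<And>i. (\<lambda>x. Dg x $ i) \<in> Ck k"
    using Suc.prems by auto
  have "((\<lambda>x. a * f x + b * g x) has_derivative (\<lambda>h. (a *\<^sub>R Df x + b *\<^sub>R Dg x) \<bullet> h)) (at x)" for x
    using Df(1)[of x] Dg(1)[of x] by (auto intro!: derivative_eq_intros simp: inner_simps)
  moreover have "(\<lambda>x. (a *\<^sub>R Df x + b *\<^sub>R Dg x) $ i) \<in> Ck k" for i
    using Suc.hyps[OF Df(2)[of i] Dg(2)[of i]] by simp
  ultimately show ?case using Suc.prems
    by (auto intro!: continuous_intros exI[of _ "\<lambda>x. a *\<^sub>R Df x + b *\<^sub>R Dg x"])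
qed

lemma test_fun_lincomb:
  assumes "\<phi> \<in> test_fun" "\<psi> \<in> test_fun"
  shows "(\<lambda>x. a * \<phi> x + b * \<psi> x) \<in> test_fun"
proof -
  have "closure {x. a * \<phi> x + b * \<psi> x \<noteq> 0} \<subseteq> closure ({x. \<phi> x \<noteq> 0} \<union> {x. \<psi> x \<noteq> 0})"
    by (rule closure_mono) auto
  then have "closure {x. a * \<phi> x + b * \<psi> x \<noteq> 0} \<subseteq> closure {x. \<phi> x \<noteq> 0} \<union> closure {x. \<psi> x \<noteq> 0}"
    by simp
  moreover have "compact (closure {x. \<phi> x \<noteq> 0} \<union> closure {x. \<psi> x \<noteq> 0})"
    using assms by (intro compact_Un) (auto simp: test_fun_def)
  ultimately have "compact (closure {x. a * \<phi> x + b * \<psi> x \<noteq> 0})"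
    using bounded_subset compact_eq_bounded_closed closed_closure by blast
  moreover have "(\<lambda>x. a * \<phi> x + b * \<psi> x) \<in> Ck k" for k
    using assms by (intro Ck_lincomb) (simp_all add: test_fun_def smooth_def)
  ultimately show ?thesis by (simp add: test_fun_def smooth_def)
qed

lemma grad_eqI:
  assumes "(f has_derivative (\<lambda>h. D \<bullet> h)) (at x)"
  shows "grad f x = D"
  using frechet_derivative_at[OF assms, symmetric] by (simp add: grad_def vec_eq_iff inner_axis)

lemma test_fun_has_derivative:
  assumes "\<phi> \<in> test_fun"
  shows "(\<phi> has_derivative (\<lambda>h. grad \<phi> x \<bullet> h)) (at x)"
proof -
  have "\<phi> \<in> Ck (Suc 0)" using assms by (auto simp only: test_fun_def smooth_def)
  then obtain D where "\<And>x. (\<phi> has_derivative (\<lambda>h. D x \<bullet> h)) (at x)" by auto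
  then show ?thesis using grad_eqI by metis
qed

lemma test_fun_continuous_grad:
  assumes "\<phi> \<in> test_fun"
  shows "continuous_on UNIV (grad \<phi>)"
proof -
  have "\<phi> \<in> Ck (Suc 0)" using assms by (auto simp only: test_fun_def smooth_def)
  then obtain D where D: "\<And>x. (\<phi> has_derivative (\<lambda>h. D x \<bullet> h)) (at x)"
      "\<And>i. continuous_on UNIV (\<lambda>x. D x $ i)" by auto
  have "continuous_on UNIV (\<lambda>x. \<chi> i. D x $ i)" by (intro continuous_on_vec_lambda D(2))
  moreover have "grad \<phi> = D" using grad_eqI[OF D(1)] by auto
  ultimately show ?thesis by simp
qed

lemma test_fun_continuous:
  assumes "\<phi> \<in> test_fun"
  shows "continuous_on UNIV \<phi>"
  by (intro continuous_at_imp_continuous_on ballI has_derivative_continuous[OF test_fun_has_derivative[OF assms]])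

text \<open>The gradient vanishes off the support too, because the complement of the closed support
  is open and the function is zero on it.\<close>

lemma test_fun_support:
  assumes "\<phi> \<in> test_fun"
  obtains R where "R > 0" "\<And>x. norm x \<ge> R \<Longrightarrow> \<phi> x = 0" "\<And>x. norm x \<ge> R \<Longrightarrow> grad \<phi> x = 0"
proof -
  let ?K = "closure {x. \<phi> x \<noteq> 0}"
  have "bounded ?K" using assms by (auto simp: test_fun_def compact_imp_bounded)
  then obtain R where R: "R > 0" "\<And>x. x \<in> ?K \<Longrightarrow> norm x < R" by (meson bounded_pos_less)
  have out: "x \<notin> ?K" if "norm x \<ge> R" for x using R(2) that by force
  have "\<phi> x = 0" if "norm x \<ge> R" for x
    using out[OF that] closure_subset[of "{x. \<phi> x \<noteq> 0}"] by auto
  moreover have "grad \<phi> x = 0" if "norm x \<ge> R" for x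
  proof (rule grad_eqI)
    have "((\<lambda>_. 0 :: real) has_derivative (\<lambda>h. 0 \<bullet> h)) (at x)" by simp
    then show "(\<phi> has_derivative (\<lambda>h. 0 \<bullet> h)) (at x)"
    proof (rule has_derivative_transform_within_open)
      show "open (- ?K)" by auto
      show "x \<in> - ?K" using out[OF that] by simp
      show "0 = \<phi> y" if "y \<in> - ?K" for y
        using that closure_subset[of "{x. \<phi> x \<noteq> 0}"] by auto
    qed
  qed
  ultimately show thesis using R(1) that by blast
qed

lemma integrable_continuous_bounded_support:
  fixes f :: "'a::euclidean_space \<Rightarrow> real"
  assumes "continuous_on UNIV f" and out: "\<And>x. norm x \<ge> R \<Longrightarrow> f x = 0"
  shows "integrable lborel f"
proof -
  have "integrable lborel (\<lambda>x. indicator (cball 0 R) x *\<^sub>R f x)"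
    using assms(1) by (intro borel_integrable_compact) (auto intro: continuous_on_subset)
  also have "(\<lambda>x. indicator (cball 0 R) x *\<^sub>R f x) = f"
    using out by (auto simp: indicator_def fun_eq_iff)
  finally show ?thesis .
qed

lemma tendsto_zero_if_less_inverse_Suc:
  fixes a :: "nat \<Rightarrow> real"
  assumes "\<And>n. 0 \<le> a n" "\<And>n. a n < 1 / real (Suc n)"
  shows "a \<longlonglongrightarrow> 0"
proof (rule tendsto_sandwich[OF _ _ tendsto_const LIMSEQ_inverse_real_of_nat])
  show "\<forall>\<^sub>F n in sequentially. a n \<le> inverse (real (Suc n))"
    using assms(2) by (intro always_eventually allI less_imp_le) (simp add: inverse_eq_divide)
qed (use assms(1) in simp)

section \<open>The weighted space as a closed subset of a vector-valued L2\<close>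

text \<open>This map identifies the \<open>V\<close>-inner product with that of \<open>L\<^sup>2(\<real>\<^sup>2; \<real> \<times> \<real>\<^sup>2)\<close>.\<close>

definition weighted_pair :: "(pt \<Rightarrow> real) \<Rightarrow> (pt \<Rightarrow> real) \<times> (pt \<Rightarrow> pt) \<Rightarrow> pt \<Rightarrow> real \<times> pt" where
  "weighted_pair V v x = (sqrt (V x) * fst v x, snd v x)"

abbreviation test_pair :: "(pt \<Rightarrow> real) \<Rightarrow> (pt \<Rightarrow> real) \<times> (pt \<Rightarrow> pt)" where
  "test_pair \<phi> \<equiv> (\<phi>, grad \<phi>)"

locale positive_potential =
  fixes V :: "pt \<Rightarrow> real"
  assumes V_cont: "continuous_on UNIV V" and V_pos: "\<And>x. V x > 0"
begin

abbreviation E where "E \<equiv> weighted_pair V"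
abbreviation L2E where "L2E \<equiv> L2_space (lborel :: pt measure) :: (pt \<Rightarrow> real \<times> pt) set"
text \<open>The \<^emph>\<open>squared\<close> distance.\<close>
abbreviation distE where "distE F G \<equiv> L2_inner lborel (\<lambda>x. F x - G x) (\<lambda>x. F x - (G x :: real \<times> pt))"

lemma V_measurable [measurable]: "V \<in> borel_measurable borel"
  using V_cont by (rule borel_measurable_continuous_onI)

lemma V_nonneg [simp]: "0 \<le> V x" using V_pos less_imp_le by blast

lemma norm_E_diff: "(norm (E v x - E w x))\<^sup>2 = (norm (snd v x - snd w x))\<^sup>2 + V x * (fst v x - fst w x)\<^sup>2"
proof -
  have "E v x - E w x = (sqrt (V x) * (fst v x - fst w x), snd v x - snd w x)"
    by (simp add: weighted_pair_def right_diff_distrib)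
  then show ?thesis by (simp add: norm_Pair power_mult_distrib)
qed

lemma norm_E: "(norm (E v x))\<^sup>2 = (norm (snd v x))\<^sup>2 + V x * (fst v x)\<^sup>2"
  by (simp add: weighted_pair_def norm_Pair power_mult_distrib)

lemma innerV_eq: "innerV V v w = L2_inner lborel (E v) (E w)"
proof -
  have "snd v x \<bullet> snd w x + V x * fst v x * fst w x = E v x \<bullet> E w x" for x
  proof -
    have "E v x \<bullet> E w x = (sqrt (V x) * sqrt (V x)) * fst v x * fst w x + snd v x \<bullet> snd w x"
      unfolding weighted_pair_def inner_prod_def fst_conv snd_conv inner_real_def by (simp only: ac_simps)
    then show ?thesis by simp
  qed
  then show ?thesis by (simp only: innerV_def L2_inner_def)
qed

lemma normV_sq_eq: "normV_sq V v = L2_inner lborel (E v) (E v)"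
  by (simp add: normV_sq_def innerV_eq)

lemma E_measurable:
  assumes [measurable]: "fst v \<in> borel_measurable lborel" "snd v \<in> borel_measurable lborel"
  shows "E v \<in> borel_measurable lborel"
  unfolding weighted_pair_def[abs_def] by measurable

lemma test_E_L2:
  assumes \<phi>: "\<phi> \<in> test_fun"
  shows "E (test_pair \<phi>) \<in> L2E"
proof -
  have [measurable]: "\<phi> \<in> borel_measurable borel" "grad \<phi> \<in> borel_measurable borel"
    using test_fun_continuous[OF \<phi>] test_fun_continuous_grad[OF \<phi>]
    by (auto intro: borel_measurable_continuous_onI)
  obtain R where "R > 0" "\<And>x. norm x \<ge> R \<Longrightarrow> \<phi> x = 0" "\<And>x. norm x \<ge> R \<Longrightarrow> grad \<phi> x = 0"
    using test_fun_support[OF \<phi>] by blast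
  then have "integrable lborel (\<lambda>x. (norm (grad \<phi> x))\<^sup>2 + V x * (\<phi> x)\<^sup>2)"
    by (intro integrable_continuous_bounded_support[of _ R] continuous_intros V_cont
        test_fun_continuous[OF \<phi>] test_fun_continuous_grad[OF \<phi>]) auto
  then show ?thesis using E_measurable[of "test_pair \<phi>"] by (simp add: L2_space_def norm_E)
qed

lemma H1V_alt: "v \<in> H1V V \<longleftrightarrow> fst v \<in> borel_measurable lborel \<and> snd v \<in> borel_measurable lborel
    \<and> (\<exists>\<phi>. (\<forall>n. \<phi> n \<in> test_fun) \<and>
      (\<lambda>n. \<integral>\<^sup>+x. ennreal ((norm (E v x - E (test_pair (\<phi> n)) x))\<^sup>2) \<partial>lborel) \<longlonglongrightarrow> 0)"
  unfolding norm_E_diff by (cases v) (simp only: H1V_def mem_Collect_eq prod.case fst_conv snd_conv)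

lemma test_approx_sequence:
  assumes "\<forall>e>0. \<exists>\<phi>\<in>test_fun. distE F (E (test_pair \<phi>)) < e"
  obtains \<phi> where "\<And>n. \<phi> n \<in> test_fun" "(\<lambda>n. distE F (E (test_pair (\<phi> n)))) \<longlonglongrightarrow> 0"
proof -
  have "\<forall>n. \<exists>\<phi>. \<phi> \<in> test_fun \<and> distE F (E (test_pair \<phi>)) < 1 / real (Suc n)"
  proof
    fix n
    have "1 / real (Suc n) > 0" by simp
    then show "\<exists>\<phi>. \<phi> \<in> test_fun \<and> distE F (E (test_pair \<phi>)) < 1 / real (Suc n)" using assms by blast
  qed
  from choice[OF this] obtain \<phi> where \<phi>: "\<And>n. \<phi> n \<in> test_fun"
    and d: "\<And>n. distE F (E (test_pair (\<phi> n))) < 1 / real (Suc n)" by blast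
  have "(\<lambda>n. distE F (E (test_pair (\<phi> n)))) \<longlonglongrightarrow> 0"
    by (rule tendsto_zero_if_less_inverse_Suc[OF L2_inner_self_nonneg d])
  with \<phi> show thesis by (rule that)
qed

text \<open>Replaces convergence of extended integrals by approximation in a real-valued squared
  distance. Square-integrability of \<open>E v\<close> follows because \<open>v\<close> differs from
  some test function by an element of finite norm.\<close>

lemma H1V_iff: "v \<in> H1V V \<longleftrightarrow> fst v \<in> borel_measurable lborel \<and> snd v \<in> borel_measurable lborel
    \<and> E v \<in> L2E \<and> (\<forall>e>0. \<exists>\<phi>\<in>test_fun. distE (E v) (E (test_pair \<phi>)) < e)" (is "_ \<longleftrightarrow> ?R")
proof
  assume "v \<in> H1V V"
  then obtain \<phi> where [measurable]: "fst v \<in> borel_measurable lborel" "snd v \<in> borel_measurable lborel"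
    and \<phi>: "\<And>n. \<phi> n \<in> test_fun"
    and lim: "(\<lambda>n. \<integral>\<^sup>+x. ennreal ((norm (E v x - E (test_pair (\<phi> n)) x))\<^sup>2) \<partial>lborel) \<longlonglongrightarrow> 0"
    unfolding H1V_alt by blast
  have [measurable]: "E v \<in> borel_measurable lborel" by (rule E_measurable) measurable
  have small: "\<exists>n. (\<integral>\<^sup>+x. ennreal ((norm (E v x - E (test_pair (\<phi> n)) x))\<^sup>2) \<partial>lborel) < ennreal e"
    if "e > 0" for e
  proof -
    have "\<forall>\<^sub>F n in sequentially. (\<integral>\<^sup>+x. ennreal ((norm (E v x - E (test_pair (\<phi> n)) x))\<^sup>2) \<partial>lborel) < ennreal e"
      using that by (intro order_tendstoD(2)[OF lim]) simp
    then show ?thesis using eventually_happens'[OF sequentially_bot] by blast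
  qed
  have T: "E (test_pair (\<phi> n)) \<in> L2E" for n by (rule test_E_L2[OF \<phi>])
  have D: "(\<lambda>x. E v x - E (test_pair (\<phi> n)) x) \<in> L2E"
    if "(\<integral>\<^sup>+x. ennreal ((norm (E v x - E (test_pair (\<phi> n)) x))\<^sup>2) \<partial>lborel) < ennreal e" for n e
    using that L2_measurable[OF T[of n]] by (intro L2_I_nn_integral) (auto intro: less_trans)
  obtain n1 where n1: "(\<integral>\<^sup>+x. ennreal ((norm (E v x - E (test_pair (\<phi> n1)) x))\<^sup>2) \<partial>lborel) < ennreal 1"
    using small[of 1] by auto
  from L2_add[OF D[OF n1] T[of n1]] have EL: "E v \<in> L2E" by simp
  have "\<exists>\<phi>\<in>test_fun. distE (E v) (E (test_pair \<phi>)) < e" if e: "e > 0" for e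
  proof -
    obtain n where n: "(\<integral>\<^sup>+x. ennreal ((norm (E v x - E (test_pair (\<phi> n)) x))\<^sup>2) \<partial>lborel) < ennreal e"
      using small[OF e] by blast
    then have "distE (E v) (E (test_pair (\<phi> n))) < e"
      by (simp only: nn_integral_L2[OF D[OF n]] ennreal_less_iff[OF L2_inner_self_nonneg])
    then show ?thesis using \<phi> by blast
  qed
  then show ?R using EL by simp
next
  assume R: ?R
  then obtain \<phi> where \<phi>: "\<And>n. \<phi> n \<in> test_fun"
    and lim: "(\<lambda>n. distE (E v) (E (test_pair (\<phi> n)))) \<longlonglongrightarrow> 0" using test_approx_sequence by blast
  have "(\<lambda>n. ennreal (distE (E v) (E (test_pair (\<phi> n))))) \<longlonglongrightarrow> ennreal 0" by (rule tendsto_ennrealI[OF lim])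
  then have "(\<lambda>n. \<integral>\<^sup>+x. ennreal ((norm (E v x - E (test_pair (\<phi> n)) x))\<^sup>2) \<partial>lborel) \<longlonglongrightarrow> 0"
    using R by (simp only: nn_integral_L2[OF L2_diff[OF _ test_E_L2[OF \<phi>]]] ennreal_0)
  then show "v \<in> H1V V" using R \<phi> unfolding H1V_alt by blast
qed

lemma H1V_L2: "v \<in> H1V V \<Longrightarrow> E v \<in> L2E"
  using H1V_iff by blast

lemma H1V_approx:
  assumes "v \<in> H1V V"
  obtains \<phi> where "\<And>n. \<phi> n \<in> test_fun" "(\<lambda>n. distE (E (test_pair (\<phi> n))) (E v)) \<longlonglongrightarrow> 0"
proof -
  obtain \<phi> where \<phi>: "\<And>n. \<phi> n \<in> test_fun"
    and lim: "(\<lambda>n. distE (E v) (E (test_pair (\<phi> n)))) \<longlonglongrightarrow> 0"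
    using test_approx_sequence assms unfolding H1V_iff by blast
  have "distE (E v) F = distE F (E v)" for F
    by (simp add: L2_inner_self norm_minus_commute)
  with lim have "(\<lambda>n. distE (E (test_pair (\<phi> n))) (E v)) \<longlonglongrightarrow> 0" by (simp only:)
  with \<phi> show thesis by (rule that)
qed

text \<open>\<open>E\<close> is linear at each point, so the midpoint of two images is the image of
  an explicit pair, and averaging the approximants approximates it.\<close>

lemma H1V_midpoint:
  assumes v: "v \<in> H1V V" and w: "w \<in> H1V V"
  shows "(\<lambda>x. (1/2) *\<^sub>R (E v x + E w x)) \<in> E ` H1V V"
proof
  let ?m = "(\<lambda>x. (fst v x + fst w x) / 2, \<lambda>x. (1/2) *\<^sub>R (snd v x + snd w x))"
  show eq: "(\<lambda>x. (1/2) *\<^sub>R (E v x + E w x)) = E ?m"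
    by (auto simp: weighted_pair_def fun_eq_iff algebra_simps add_divide_distrib)
  have [measurable]: "fst v \<in> borel_measurable lborel" "snd v \<in> borel_measurable lborel"
     "fst w \<in> borel_measurable lborel" "snd w \<in> borel_measurable lborel"
    using v w unfolding H1V_iff by blast+
  have "E ?m \<in> L2E"
    unfolding eq[symmetric] by (intro L2_scale L2_add H1V_L2 v w)
  moreover have "\<exists>\<eta>\<in>test_fun. distE (E ?m) (E (test_pair \<eta>)) < e" if "e > 0" for e
  proof -
    obtain \<phi> \<psi> where \<phi>: "\<phi> \<in> test_fun" "distE (E v) (E (test_pair \<phi>)) < e"
      and \<psi>: "\<psi> \<in> test_fun" "distE (E w) (E (test_pair \<psi>)) < e"
      using v w \<open>e > 0\<close> unfolding H1V_iff by blast
    let ?\<eta> = "\<lambda>x. (1/2) * \<phi> x + (1/2) * \<psi> x"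
    have \<eta>: "?\<eta> \<in> test_fun" by (rule test_fun_lincomb[OF \<phi>(1) \<psi>(1)])
    have g: "grad ?\<eta> x = (1/2) *\<^sub>R grad \<phi> x + (1/2) *\<^sub>R grad \<psi> x" for x
      using test_fun_has_derivative[OF \<phi>(1), of x] test_fun_has_derivative[OF \<psi>(1), of x]
      by (intro grad_eqI) (auto intro!: derivative_eq_intros simp: inner_simps)
    let ?A = "\<lambda>x. E v x - E (test_pair \<phi>) x" and ?B = "\<lambda>x. E w x - E (test_pair \<psi>) x"
    have A: "?A \<in> L2E" and B: "?B \<in> L2E"
      by (intro L2_diff H1V_L2 v w test_E_L2 \<phi> \<psi>)+
    have "(\<lambda>x. E ?m x - E (test_pair ?\<eta>) x) = (\<lambda>x. (1/2) *\<^sub>R (?A x + ?B x))"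
      unfolding weighted_pair_def fst_conv snd_conv g
      by (simp add: fun_eq_iff algebra_simps add_divide_distrib)
    then have "distE (E ?m) (E (test_pair ?\<eta>)) = L2_inner lborel (\<lambda>x. (1/2) *\<^sub>R (?A x + ?B x)) (\<lambda>x. (1/2) *\<^sub>R (?A x + ?B x))"
      by simp
    also have "\<dots> \<le> (2 * L2_inner lborel ?A ?A + 2 * L2_inner lborel ?B ?B) / 4"
      by (rule L2_midpoint_le[OF A B])
    also have "\<dots> < e" using \<phi>(2) \<psi>(2) by simp
    finally show ?thesis using \<eta> by blast
  qed
  moreover have "fst ?m \<in> borel_measurable lborel" "snd ?m \<in> borel_measurable lborel"
    unfolding fst_conv snd_conv by measurable
  ultimately show "?m \<in> H1V V" unfolding H1V_iff by blast
qed

text \<open>Since \<open>V\<close> is positive, \<open>E\<close> is inverted pointwise by dividing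
  the first component by sqrt V; approximability by test functions survives the limit.\<close>

lemma H1V_closed:
  assumes S: "\<And>n. S n \<in> E ` H1V V" and G: "G \<in> L2E" and lim: "(\<lambda>n. distE (S n) G) \<longlonglongrightarrow> 0"
  shows "G \<in> E ` H1V V"
proof
  let ?v = "(\<lambda>x. fst (G x) / sqrt (V x), \<lambda>x. snd (G x))"
  have "sqrt (V x) \<noteq> 0" for x using V_pos[of x] by simp
  then show eq: "G = E ?v" by (auto simp: weighted_pair_def fun_eq_iff)
  have Gm: "G \<in> borel_measurable lborel" using G by (rule L2_measurable)
  have [measurable]: "(\<lambda>x. fst (G x)) \<in> borel_measurable lborel" "(\<lambda>x. snd (G x)) \<in> borel_measurable lborel"
    by (rule measurable_compose[OF Gm borel_measurable_continuous_onI], intro continuous_intros)+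
  have "\<exists>\<phi>\<in>test_fun. distE (E ?v) (E (test_pair \<phi>)) < e" if "e > 0" for e
  proof -
    \<comment> \<open>Two squared distances below e / 4, each doubled by the triangle inequality,
      sum to less than \<open>e\<close>.\<close>
    have "\<forall>\<^sub>F n in sequentially. distE (S n) G < e / 4"
      using \<open>e > 0\<close> by (intro order_tendstoD(2)[OF lim]) simp
    then obtain n where n: "distE (S n) G < e / 4"
      using eventually_happens'[OF sequentially_bot] by blast
    obtain w where w: "w \<in> H1V V" "S n = E w" using S by blast
    obtain \<phi> where \<phi>: "\<phi> \<in> test_fun" "distE (E w) (E (test_pair \<phi>)) < e / 4"
      using w(1) \<open>e > 0\<close> unfolding H1V_iff by (meson zero_less_divide_iff zero_less_numeral)
    have "distE G (S n) = distE (S n) G" by (simp add: L2_inner_self norm_minus_commute)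
    then have "distE G (E (test_pair \<phi>)) < e"
      using L2_inner_diff_self_le[OF G test_E_L2[OF \<phi>(1)] H1V_L2[OF w(1)]] n \<phi>(2) w(2) by simp
    then show ?thesis using \<phi>(1) eq by auto
  qed
  moreover have "fst ?v \<in> borel_measurable lborel" "snd ?v \<in> borel_measurable lborel"
    unfolding fst_conv snd_conv by measurable
  ultimately show "?v \<in> H1V V" using G unfolding H1V_iff eq[symmetric] by blast
qed

text \<open>Convergence is asserted against all of \<open>L2E\<close>, not only against images of
  \<open>H1V\<close>: the ball averages used later are pairings with elements of zero gradient part,
  which need not be such images.\<close>

theorem H1V_weakly_compact:
  assumes u: "\<And>n. u n \<in> H1V V" and bound: "\<And>n. normV_sq V (u n) \<le> K"
  shows "\<exists>r u0. strict_mono (r :: nat \<Rightarrow> nat) \<and> u0 \<in> H1V V \<and>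
    (\<forall>w\<in>L2E. (\<lambda>n. L2_inner lborel (E (u (r n))) w) \<longlonglongrightarrow> L2_inner lborel (E u0) w)"
proof (rule L2_weakly_sequentially_compact[of "E ` H1V V" lborel "\<lambda>n. E (u n)" K])
  show "E ` H1V V \<subseteq> L2E" using H1V_L2 by blast
  show "(\<lambda>x. (1/2) *\<^sub>R (A x + B x)) \<in> E ` H1V V"
    if "A \<in> E ` H1V V" "B \<in> E ` H1V V" for A B using that H1V_midpoint by blast
  show "G \<in> E ` H1V V" if "\<And>n. S n \<in> E ` H1V V" "G \<in> L2E" "(\<lambda>n. distE (S n) G) \<longlonglongrightarrow> 0" for S G
    using that by (rule H1V_closed)
  show "E (u n) \<in> E ` H1V V" for n using u by blast
  show "L2_inner lborel (E (u n)) (E (u n)) \<le> K" for n using bound by (simp only: normV_sq_eq)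
  show ?thesis if "strict_mono r" "Y \<in> E ` H1V V"
    "\<And>w. w \<in> L2E \<Longrightarrow> (\<lambda>n. L2_inner lborel (E (u (r n))) w) \<longlonglongrightarrow> L2_inner lborel Y w"
    for r :: "nat \<Rightarrow> nat" and Y
    using that by blast
qed

end

section \<open>The Gagliardo--Nirenberg inequality in the plane\<close>

definition pt_of :: "real \<Rightarrow> real \<Rightarrow> pt" where
  "pt_of s t = s *\<^sub>R axis 1 1 + t *\<^sub>R axis 2 1"

lemma pt_of_nth [simp]: "pt_of s t $ 1 = s" "pt_of s t $ 2 = t"
  by (simp_all add: pt_of_def axis_def)

lemma pt_of_measurable [measurable]:
  assumes [measurable]: "f \<in> borel_measurable M" "g \<in> borel_measurable M"
  shows "(\<lambda>x. pt_of (f x) (g x)) \<in> borel_measurable M"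
  unfolding pt_of_def by measurable

lemma pt_of_measurable_pair: "(\<lambda>(s, t). pt_of s t) \<in> borel_measurable (lborel \<Otimes>\<^sub>M lborel)"
  by measurable

text \<open>Lebesgue measure is determined by its values on boxes. This is the bridge from vectors
  to pairs that makes Tonelli's theorem available.\<close>

lemma lborel_pt: "(lborel :: pt measure) = distr (lborel \<Otimes>\<^sub>M lborel) borel (\<lambda>(s, t). pt_of s t)"
proof (rule lborel_eqI)
  fix l u :: pt assume le: "\<And>b. b \<in> Basis \<Longrightarrow> l \<bullet> b \<le> u \<bullet> b"
  have le': "l $ i \<le> u $ i" for i using le[of "axis i 1"] by (auto simp: inner_axis axis_in_Basis_iff)
  have vim: "(\<lambda>(s, t). pt_of s t) -` box l u \<inter> space (lborel \<Otimes>\<^sub>M lborel) = {l$1<..<u$1} \<times> {l$2<..<u$2}"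
    by (auto simp: space_pair_measure mem_box_cart forall_2)
  have "emeasure (distr (lborel \<Otimes>\<^sub>M lborel) borel (\<lambda>(s, t). pt_of s t)) (box l u)
     = emeasure (lborel \<Otimes>\<^sub>M lborel) ({l$1<..<u$1} \<times> {l$2<..<u$2})"
    by (subst emeasure_distr[OF pt_of_measurable_pair]) (auto simp: vim)
  also have "\<dots> = ennreal (u$1 - l$1) * ennreal (u$2 - l$2)"
    using le' by (subst lborel.emeasure_pair_measure_Times) auto
  also have "\<dots> = ennreal ((u$1 - l$1) * (u$2 - l$2))"
    using le' by (simp add: ennreal_mult)
  also have "(u$1 - l$1) * (u$2 - l$2) = (\<Prod>i\<in>UNIV. (u - l) $ i)"
    by (simp add: UNIV_2)
  also have "\<dots> = (\<Prod>b\<in>(\<lambda>i. axis i 1) ` UNIV. (u - l) \<bullet> b)"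
    by (subst prod.reindex) (auto simp: inj_on_def axis_eq_axis inner_axis)
  also have "(\<lambda>i. axis i 1) ` UNIV = (Basis :: pt set)"
    by (auto simp: Basis_vec_def)
  finally show "emeasure (distr (lborel \<Otimes>\<^sub>M lborel) borel (\<lambda>(s, t). pt_of s t)) (box l u)
     = (\<Prod>b\<in>Basis. (u - l) \<bullet> b)" .
qed simp

lemma nn_integral_pt:
  assumes [measurable]: "f \<in> borel_measurable borel"
  shows "(\<integral>\<^sup>+x. f x \<partial>lborel) = (\<integral>\<^sup>+s. \<integral>\<^sup>+t. f (pt_of s t) \<partial>lborel \<partial>lborel)"
proof -
  have "(\<integral>\<^sup>+x. f x \<partial>lborel) = (\<integral>\<^sup>+z. f (case z of (s, t) \<Rightarrow> pt_of s t) \<partial>(lborel \<Otimes>\<^sub>M lborel))"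
    by (subst lborel_pt, subst nn_integral_distr[OF pt_of_measurable_pair]) auto
  also have "\<dots> = (\<integral>\<^sup>+s. \<integral>\<^sup>+t. f (case (s, t) of (s, t) \<Rightarrow> pt_of s t) \<partial>lborel \<partial>lborel)"
    by (rule lborel.nn_integral_fst[symmetric]) (use pt_of_measurable_pair in measurable)
  finally show ?thesis by simp
qed

lemma nn_integral_pt':
  assumes [measurable]: "f \<in> borel_measurable borel"
  shows "(\<integral>\<^sup>+x. f x \<partial>lborel) = (\<integral>\<^sup>+t. \<integral>\<^sup>+s. f (pt_of s t) \<partial>lborel \<partial>lborel)"
  unfolding nn_integral_pt[OF assms] by (rule lborel_pair.Fubini') measurable

text \<open>The fundamental theorem of calculus with an extended-valued right side, so that it can
  be enlarged to integrals that may be infinite.\<close>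

lemma abs_diff_le_nn_integral_deriv:
  fixes f f' :: "real \<Rightarrow> real"
  assumes "a \<le> b" and der: "\<And>s. (f has_real_derivative f' s) (at s)" and cont: "continuous_on UNIV f'"
  shows "ennreal \<bar>f b - f a\<bar> \<le> (\<integral>\<^sup>+s. ennreal \<bar>f' s\<bar> * indicator {a..b} s \<partial>lborel)"
proof -
  have "has_bochner_integral lborel (\<lambda>s. f' s * indicator {a..b} s) (f b - f a)"
    using assms cont by (intro has_bochner_integral_FTC_Icc_real)
      (auto simp: continuous_on_eq_continuous_at)
  then have "integrable lborel (\<lambda>s. f' s * indicator {a..b} s)"
    and eq: "f b - f a = (\<integral>s. f' s * indicator {a..b} s \<partial>lborel)"
    by (auto simp: has_bochner_integral_iff)
  then have "ennreal (norm (\<integral>s. f' s * indicator {a..b} s \<partial>lborel))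
      \<le> (\<integral>\<^sup>+s. ennreal (norm (f' s * indicator {a..b} s)) \<partial>lborel)"
    by (intro integral_norm_bound_ennreal)
  also have "\<dots> = (\<integral>\<^sup>+s. ennreal \<bar>f' s\<bar> * indicator {a..b} s \<partial>lborel)"
    by (intro nn_integral_cong) (auto simp: indicator_def)
  finally show ?thesis using eq by simp
qed

text \<open>The derivative is integrated from a zero of \<open>w\<close> on the line. Enlarging the
  interval to the whole line makes the bound independent of \<open>t\<close>.\<close>

lemma Gagliardo_Nirenberg_line:
  fixes w :: "pt \<Rightarrow> real" and b x :: pt
  assumes der: "\<And>x. (w has_derivative (\<lambda>h. Dw x \<bullet> h)) (at x)" and cont: "continuous_on UNIV Dw"
    and b: "norm b = 1" and r: "w (x + r *\<^sub>R b) = 0" "r \<le> t"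
  shows "ennreal \<bar>w (x + t *\<^sub>R b)\<bar> \<le> (\<integral>\<^sup>+s. ennreal (norm (Dw (x + s *\<^sub>R b))) \<partial>lborel)"
proof -
  have "((\<lambda>s. w (x + s *\<^sub>R b)) has_derivative (\<lambda>h. Dw (x + s *\<^sub>R b) \<bullet> (h *\<^sub>R b))) (at s)" for s
  proof -
    have "((\<lambda>s. x + s *\<^sub>R b) has_derivative (\<lambda>h. h *\<^sub>R b)) (at s)"
      by (auto intro!: derivative_eq_intros)
    from has_derivative_compose[OF this der] show ?thesis by simp
  qed
  then have "((\<lambda>s. w (x + s *\<^sub>R b)) has_real_derivative (Dw (x + s *\<^sub>R b) \<bullet> b)) (at s)" for s
    unfolding has_field_derivative_def by (rule has_derivative_eq_rhs) (simp add: fun_eq_iff)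
  moreover have "continuous_on UNIV (\<lambda>s. Dw (x + s *\<^sub>R b) \<bullet> b)"
    by (intro continuous_intros continuous_on_compose2[OF cont]) auto
  ultimately have "ennreal \<bar>w (x + t *\<^sub>R b) - w (x + r *\<^sub>R b)\<bar>
      \<le> (\<integral>\<^sup>+s. ennreal \<bar>Dw (x + s *\<^sub>R b) \<bullet> b\<bar> * indicator {r..t} s \<partial>lborel)"
    using r(2) by (intro abs_diff_le_nn_integral_deriv)
  also have "\<dots> \<le> (\<integral>\<^sup>+s. ennreal (norm (Dw (x + s *\<^sub>R b))) \<partial>lborel)"
  proof (rule nn_integral_mono)
    fix s
    have "\<bar>Dw (x + s *\<^sub>R b) \<bullet> b\<bar> \<le> norm (Dw (x + s *\<^sub>R b))"
      using Cauchy_Schwarz_ineq2[of "Dw (x + s *\<^sub>R b)" b] b by simp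
    then show "ennreal \<bar>Dw (x + s *\<^sub>R b) \<bullet> b\<bar> * indicator {r..t} s \<le> ennreal (norm (Dw (x + s *\<^sub>R b)))"
      by (auto simp: indicator_def intro: ennreal_leI)
  qed
  finally show ?thesis using r(1) by simp
qed

text \<open>One factor of w^2 is bounded by the integral of |Dw| along the horizontal line through
  the point, the other along the vertical line. Each bound depends on a single coordinate, so the
  double integral factors.\<close>

theorem Gagliardo_Nirenberg_plane:
  fixes w :: "pt \<Rightarrow> real"
  assumes der: "\<And>x. (w has_derivative (\<lambda>h. Dw x \<bullet> h)) (at x)" and cont: "continuous_on UNIV Dw"
    and R: "\<And>x. norm x \<ge> R \<Longrightarrow> w x = 0"
  shows "(\<integral>\<^sup>+x. ennreal ((w x)\<^sup>2) \<partial>lborel) \<le> (\<integral>\<^sup>+x. ennreal (norm (Dw x)) \<partial>lborel)\<^sup>2"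
proof -
  have [measurable]: "Dw \<in> borel_measurable borel" using cont by (rule borel_measurable_continuous_onI)
  have "continuous_on UNIV w"
    by (intro continuous_at_imp_continuous_on ballI has_derivative_continuous[OF der])
  then have [measurable]: "w \<in> borel_measurable borel" by (rule borel_measurable_continuous_onI)
  let ?I = "\<integral>\<^sup>+x. ennreal (norm (Dw x)) \<partial>lborel"
  let ?B = "\<lambda>s. \<integral>\<^sup>+t. ennreal (norm (Dw (pt_of s t))) \<partial>lborel"
  let ?A = "\<lambda>t. \<integral>\<^sup>+s. ennreal (norm (Dw (pt_of s t))) \<partial>lborel"
  have bound: "ennreal \<bar>w (pt_of s t)\<bar> \<le> ?A t" "ennreal \<bar>w (pt_of s t)\<bar> \<le> ?B s" for s t
  proof -
    \<comment> \<open>A coordinate at most -|R| forces norm at least \<open>R\<close> whatever its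
      sign; the minimum with \<open>c\<close> keeps the zero before the endpoint on the
      line.\<close>
    have out: "w y = 0" if "y $ i = min c (- \<bar>R\<bar>)" for y c i
      using component_le_norm_cart[of y i] that by (intro R) linarith
    have 1: "pt_of r t = t *\<^sub>R axis 2 1 + r *\<^sub>R axis 1 1" for r by (simp add: pt_of_def)
    have "w (pt_of (min s (- \<bar>R\<bar>)) t) = 0" by (rule out[of _ 1 s]) simp
    then show "ennreal \<bar>w (pt_of s t)\<bar> \<le> ?A t"
      unfolding 1 by (intro Gagliardo_Nirenberg_line[OF der cont, where r = "min s (- \<bar>R\<bar>)"]) auto
    have 2: "pt_of s r = s *\<^sub>R axis 1 1 + r *\<^sub>R axis 2 1" for r by (simp add: pt_of_def)
    have "w (pt_of s (min t (- \<bar>R\<bar>))) = 0" by (rule out[of _ 2 t]) simp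
    then show "ennreal \<bar>w (pt_of s t)\<bar> \<le> ?B s"
      unfolding 2 by (intro Gagliardo_Nirenberg_line[OF der cont, where r = "min t (- \<bar>R\<bar>)"]) auto
  qed
  have "(\<integral>\<^sup>+x. ennreal ((w x)\<^sup>2) \<partial>lborel) = (\<integral>\<^sup>+s. \<integral>\<^sup>+t. ennreal ((w (pt_of s t))\<^sup>2) \<partial>lborel \<partial>lborel)"
    by (rule nn_integral_pt) measurable
  also have "\<dots> \<le> (\<integral>\<^sup>+s. \<integral>\<^sup>+t. ?B s * ?A t \<partial>lborel \<partial>lborel)"
  proof (intro nn_integral_mono)
    fix s t
    have "ennreal ((w (pt_of s t))\<^sup>2) = ennreal \<bar>w (pt_of s t)\<bar> * ennreal \<bar>w (pt_of s t)\<bar>"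
      by (simp add: power2_eq_square flip: ennreal_mult abs_mult)
    also have "\<dots> \<le> ?B s * ?A t" by (intro mult_mono bound) auto
    finally show "ennreal ((w (pt_of s t))\<^sup>2) \<le> ?B s * ?A t" .
  qed
  also have "\<dots> = (\<integral>\<^sup>+s. ?B s * (\<integral>\<^sup>+t. ?A t \<partial>lborel) \<partial>lborel)"
    by (intro nn_integral_cong nn_integral_cmult) measurable
  also have "\<dots> = (\<integral>\<^sup>+s. ?B s \<partial>lborel) * (\<integral>\<^sup>+t. ?A t \<partial>lborel)"
    by (rule nn_integral_multc) measurable
  also have "(\<integral>\<^sup>+s. ?B s \<partial>lborel) = ?I" by (rule nn_integral_pt[symmetric]) measurable
  also have "(\<integral>\<^sup>+t. ?A t \<partial>lborel) = ?I" by (rule nn_integral_pt'[symmetric]) measurable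
  finally show ?thesis by (simp add: power2_eq_square)
qed

section \<open>Bounds for the nonlinear term\<close>

text \<open>Below 1 the square dominates, above 1 the highest power. This pointwise splitting does
  the work of interpolation between norms.\<close>

lemma power_le_sum_powers:
  fixes y :: real
  assumes "0 \<le> y" "2 \<le> q" "q \<le> n"
  shows "y ^ q \<le> y\<^sup>2 + y ^ n"
proof (cases "y \<le> 1")
  case True
  then have "y ^ q \<le> y\<^sup>2" using assms by (intro power_decreasing) auto
  then show ?thesis using assms(1) by (simp add: add_increasing2)
next
  case False
  then have "y ^ q \<le> y ^ n" using assms by (intro power_increasing) auto
  then show ?thesis using assms(1) by (simp add: add_increasing)
qed

lemma powr_le_sum_powers:
  fixes y r :: real
  assumes "0 \<le> y" "2 \<le> r" "r \<le> real n"
  shows "y powr r \<le> y\<^sup>2 + y ^ n"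
proof (cases "y = 0")
  case True
  then show ?thesis by simp
next
  case False
  then have y: "y > 0" using assms(1) by simp
  show ?thesis
  proof (cases "y \<le> 1")
    case True
    then have "y powr r \<le> y powr 2" using assms y by (intro powr_mono') auto
    then show ?thesis using y by (simp add: add_increasing2)
  next
    case False
    then have "y powr r \<le> y powr real n" using assms by (intro powr_mono) auto
    then show ?thesis using y by (simp add: powr_realpow add_increasing)
  qed
qed

text \<open>Once the squared distance to \<open>v\<close> is below half of its squared norm,
  doubling both gives 1 + 2 = 3. Positivity of the norm is what makes this distance
  attainable.\<close>

lemma (in positive_potential) H1V_test_sequence:
  assumes v: "v \<in> H1V V" and pos: "0 < normV_sq V v"
  obtains \<phi> where "\<And>n. \<phi> n \<in> test_fun" "\<And>n. normV_sq V (test_pair (\<phi> n)) \<le> 3 * normV_sq V v"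
    "AE x in lborel. (\<lambda>n. \<phi> n x) \<longlonglongrightarrow> fst v x"
proof -
  obtain \<psi> where \<psi>: "\<And>n. \<psi> n \<in> test_fun" and lim\<psi>: "(\<lambda>n. distE (E (test_pair (\<psi> n))) (E v)) \<longlonglongrightarrow> 0"
    using H1V_approx[OF v] by blast
  have EL: "E v \<in> L2E" by (rule H1V_L2[OF v])
  obtain r :: "nat \<Rightarrow> nat" where r: "strict_mono r"
    and ae: "AE x in lborel. (\<lambda>n. E (test_pair (\<psi> (r n))) x) \<longlonglongrightarrow> E v x"
    using L2_convergent_AE_subseq[of "\<lambda>n. E (test_pair (\<psi> n))" lborel "E v", OF test_E_L2[OF \<psi>] EL lim\<psi>] by blast
  have "(\<lambda>n. distE (E (test_pair (\<psi> (r n)))) (E v)) \<longlonglongrightarrow> 0"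
    using LIMSEQ_subseq_LIMSEQ[OF lim\<psi> r] by (simp add: o_def)
  from order_tendstoD(2)[OF this, of "normV_sq V v / 2"] pos
  obtain n0 where n0: "\<And>n. n \<ge> n0 \<Longrightarrow> distE (E (test_pair (\<psi> (r n)))) (E v) < normV_sq V v / 2"
    by (auto simp: eventually_sequentially)
  define \<phi> where "\<phi> n = \<psi> (r (n + n0))" for n
  have \<phi>: "\<phi> n \<in> test_fun" for n by (simp add: \<phi>_def \<psi>)
  moreover have "normV_sq V (test_pair (\<phi> n)) \<le> 3 * normV_sq V v" for n
  proof -
    have "normV_sq V (test_pair (\<phi> n)) \<le> 2 * distE (E (test_pair (\<phi> n))) (E v) + 2 * normV_sq V v"
      using L2_inner_diff_self_le[OF test_E_L2[OF \<phi>[of n]] _ EL, of "\<lambda>_. 0"]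
      by (simp add: normV_sq_eq L2_space_def)
    then show ?thesis using n0[of "n + n0"] unfolding \<phi>_def by linarith
  qed
  moreover have "AE x in lborel. (\<lambda>n. \<phi> n x) \<longlonglongrightarrow> fst v x"
    using ae
  proof eventually_elim
    fix x assume "(\<lambda>n. E (test_pair (\<psi> (r n))) x) \<longlonglongrightarrow> E v x"
    from tendsto_fst[OF LIMSEQ_ignore_initial_segment[OF this, of n0]]
    have "(\<lambda>n. sqrt (V x) * \<phi> n x) \<longlonglongrightarrow> sqrt (V x) * fst v x"
      by (simp add: weighted_pair_def \<phi>_def)
    from tendsto_divide[OF this tendsto_const[of "sqrt (V x)"]] V_pos[of x]
    show "(\<lambda>n. \<phi> n x) \<longlonglongrightarrow> fst v x" by simp
  qed
  ultimately show thesis by (rule that)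
qed

locale C1_potential = positive_potential +
  fixes DV :: "pt \<Rightarrow> pt" and C :: real
  assumes V_deriv: "\<And>x. (V has_derivative (\<lambda>h. DV x \<bullet> h)) (at x)"
    and DV_cont: "continuous_on UNIV DV"
    and C_nonneg: "C \<ge> 0"
    and DV_le: "AE x in lborel. norm (DV x) \<le> C * V x powr (3/2)"
begin

text \<open>The absolute value admits odd exponents, which occur in the iteration as
  \<open>moment q\<close>.\<close>

definition moment :: "nat \<Rightarrow> (pt \<Rightarrow> real) \<Rightarrow> real" where
  "moment m \<phi> = (\<integral>x. V x * \<bar>\<phi> x\<bar> ^ m \<partial>lborel)"

lemma test_moment_integrable:
  assumes \<phi>: "\<phi> \<in> test_fun" and "m > 0"
  shows "integrable lborel (\<lambda>x. V x * \<bar>\<phi> x\<bar> ^ m)"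
proof -
  obtain R where "R > 0" "\<And>x. norm x \<ge> R \<Longrightarrow> \<phi> x = 0" using test_fun_support[OF \<phi>] by metis
  then show ?thesis using \<open>m > 0\<close>
    by (intro integrable_continuous_bounded_support[of _ R] continuous_intros V_cont
        test_fun_continuous[OF \<phi>]) auto
qed

lemma test_grad_sq_integrable:
  assumes \<phi>: "\<phi> \<in> test_fun"
  shows "integrable lborel (\<lambda>x. (norm (grad \<phi> x))\<^sup>2)"
proof -
  obtain R where "R > 0" "\<And>x. norm x \<ge> R \<Longrightarrow> grad \<phi> x = 0" using test_fun_support[OF \<phi>] by metis
  then show ?thesis
    by (intro integrable_continuous_bounded_support[of _ R] continuous_intros test_fun_continuous_grad[OF \<phi>]) auto
qed

lemma test_normV_sq:
  assumes \<phi>: "\<phi> \<in> test_fun"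
  shows "normV_sq V (test_pair \<phi>) = (\<integral>x. (norm (grad \<phi> x))\<^sup>2 \<partial>lborel) + moment 2 \<phi>"
  using test_grad_sq_integrable[OF \<phi>] test_moment_integrable[OF \<phi>, of 2]
  by (simp add: normV_sq_eq L2_inner_self norm_E moment_def)

text \<open>Gagliardo--Nirenberg applied to \<open>\<surd>V \<phi>\<^sup>q\<close>: the hypothesis on \<open>\<nabla>V\<close> is exactly what makes the
  gradient of \<open>\<surd>V\<close> contribute a multiple of \<open>V\<close>.\<close>

lemma test_moment_step:
  assumes \<phi>: "\<phi> \<in> test_fun" and q: "q \<ge> 2"
  shows "moment (2 * q) \<phi> \<le> (C / 2 * moment q \<phi>
      + real q * sqrt (moment (2 * q - 2) \<phi> * (\<integral>x. (norm (grad \<phi> x))\<^sup>2 \<partial>lborel)))\<^sup>2"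
proof -
  define w where "w x = sqrt (V x) * \<phi> x ^ q" for x
  define Dw where "Dw x = (\<phi> x ^ q / (2 * sqrt (V x))) *\<^sub>R DV x + (real q * \<phi> x ^ (q - 1) * sqrt (V x)) *\<^sub>R grad \<phi> x" for x
  obtain R where R: "R > 0" "\<And>x. norm x \<ge> R \<Longrightarrow> \<phi> x = 0" "\<And>x. norm x \<ge> R \<Longrightarrow> grad \<phi> x = 0"
    using test_fun_support[OF \<phi>] by metis
  note cont = V_cont DV_cont test_fun_continuous[OF \<phi>] test_fun_continuous_grad[OF \<phi>]
  have sV: "sqrt (V x) \<noteq> 0" for x using V_pos[of x] by simp
  have der: "(w has_derivative (\<lambda>h. Dw x \<bullet> h)) (at x)" for x
  proof -
    have "((\<lambda>x. sqrt (V x)) has_derivative (\<lambda>h. DV x \<bullet> h * (1 / (2 * sqrt (V x))))) (at x)"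
      using V_deriv[of x] V_pos[of x] by (auto intro!: derivative_eq_intros simp: field_simps)
    moreover have "((\<lambda>x. \<phi> x ^ q) has_derivative (\<lambda>h. real q * \<phi> x ^ (q - 1) * (grad \<phi> x \<bullet> h))) (at x)"
      using test_fun_has_derivative[OF \<phi>, of x] by (auto intro!: derivative_eq_intros simp: algebra_simps)
    ultimately have "(w has_derivative (\<lambda>h. sqrt (V x) * (real q * \<phi> x ^ (q - 1) * (grad \<phi> x \<bullet> h))
        + DV x \<bullet> h * (1 / (2 * sqrt (V x))) * \<phi> x ^ q)) (at x)"
      unfolding w_def[abs_def] by (rule has_derivative_mult)
    then show ?thesis
      by (rule has_derivative_eq_rhs) (simp add: fun_eq_iff Dw_def inner_add_left)
  qed
  have Dw_cont: "continuous_on UNIV Dw"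
    unfolding Dw_def[abs_def] using sV by (intro continuous_intros cont) auto
  let ?f = "\<lambda>x. V x * \<bar>\<phi> x\<bar> ^ q" and ?g = "\<lambda>x. (sqrt (V x) * \<bar>\<phi> x\<bar> ^ (q - 1)) * norm (grad \<phi> x)"
  have Dw_le: "AE x in lborel. norm (Dw x) \<le> C / 2 * ?f x + real q * ?g x"
    using DV_le
  proof eventually_elim
    fix x assume le: "norm (DV x) \<le> C * V x powr (3/2)"
    \<comment> \<open>One factor sqrt V cancels the denominator left by differentiating sqrt V, so
      that a multiple of \<open>V\<close> itself remains.\<close>
    have V32: "V x powr (3/2) = V x * sqrt (V x)"
      using V_pos[of x] powr_add[of "V x" 1 "1/2"] by (simp add: powr_half_sqrt)
    have "norm (Dw x) \<le> \<bar>\<phi> x\<bar> ^ q / (2 * sqrt (V x)) * norm (DV x) + real q * \<bar>\<phi> x\<bar> ^ (q - 1) * sqrt (V x) * norm (grad \<phi> x)"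
      unfolding Dw_def by (rule order.trans[OF norm_triangle_ineq]) (simp add: abs_mult power_abs)
    also have "\<bar>\<phi> x\<bar> ^ q / (2 * sqrt (V x)) * norm (DV x) \<le> \<bar>\<phi> x\<bar> ^ q / (2 * sqrt (V x)) * (C * (V x * sqrt (V x)))"
      using le V_pos[of x] unfolding V32 by (intro mult_left_mono) auto
    also have "\<dots> = C / 2 * ?f x" using sV[of x] by (simp add: field_simps)
    finally show "norm (Dw x) \<le> C / 2 * ?f x + real q * ?g x" by (simp add: ac_simps)
  qed
  have intf: "integrable lborel ?f" using q by (intro test_moment_integrable \<phi>) auto
  have intg: "integrable lborel ?g"
    using R q by (intro integrable_continuous_bounded_support[of _ R] continuous_intros cont) auto
  \<comment> \<open>The weight stays with the power of the function and the gradient is left bare: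
    the square of the first factor is then the integrand of \<open>moment (2 * q - 2)\<close>, with
    positive exponent since \<open>q \<ge> 2\<close>.\<close>
  have CS: "(\<integral>x. ?g x \<partial>lborel) \<le> sqrt (moment (2 * q - 2) \<phi> * (\<integral>x. (norm (grad \<phi> x))\<^sup>2 \<partial>lborel))"
  proof -
    let ?a = "\<lambda>x. sqrt (V x) * \<bar>\<phi> x\<bar> ^ (q - 1)" and ?b = "\<lambda>x. norm (grad \<phi> x)"
    have a2: "(?a x)\<^sup>2 = V x * \<bar>\<phi> x\<bar> ^ (2 * q - 2)" for x
    proof -
      have "(\<bar>\<phi> x\<bar> ^ (q - 1))\<^sup>2 = \<bar>\<phi> x\<bar> ^ ((q - 1) * 2)" by (rule power_mult[symmetric])
      also have "(q - 1) * 2 = 2 * q - 2" by simp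
      finally show ?thesis by (simp add: power_mult_distrib)
    qed
    have "?a \<in> L2_space lborel"
    proof -
      have "continuous_on UNIV ?a" by (intro continuous_intros cont)
      then have "?a \<in> borel_measurable lborel" by (simp add: borel_measurable_continuous_onI)
      moreover have "integrable lborel (\<lambda>x. (norm (?a x))\<^sup>2)"
        using test_moment_integrable[OF \<phi>, of "2 * q - 2"] q by (simp only: real_norm_def power2_abs a2)
      ultimately show ?thesis by (simp add: L2_space_def)
    qed
    moreover have "?b \<in> L2_space lborel"
    proof -
      have "continuous_on UNIV ?b" by (intro continuous_intros cont)
      then have "?b \<in> borel_measurable lborel" by (simp add: borel_measurable_continuous_onI)
      then show ?thesis using test_grad_sq_integrable[OF \<phi>] by (simp add: L2_space_def)
    qed
    ultimately have "\<bar>L2_inner lborel ?a ?b\<bar> \<le> sqrt (L2_inner lborel ?a ?a * L2_inner lborel ?b ?b)"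
      by (rule L2_Cauchy_Schwarz_abs)
    moreover have "L2_inner lborel ?a ?a = moment (2 * q - 2) \<phi>"
      unfolding L2_inner_self moment_def by (simp only: real_norm_def power2_abs a2)
    moreover have "L2_inner lborel ?b ?b = (\<integral>x. (norm (grad \<phi> x))\<^sup>2 \<partial>lborel)"
      by (simp add: L2_inner_self)
    moreover have "L2_inner lborel ?a ?b = (\<integral>x. ?g x \<partial>lborel)" by (simp add: L2_inner_def)
    ultimately show ?thesis by simp
  qed
  have nonneg: "0 \<le> moment q \<phi>" "0 \<le> (\<integral>x. ?g x \<partial>lborel)"
    by (auto simp: moment_def intro!: integral_nonneg_AE)
  have "(\<integral>\<^sup>+x. ennreal (norm (Dw x)) \<partial>lborel) \<le> (\<integral>\<^sup>+x. ennreal (C / 2 * ?f x + real q * ?g x) \<partial>lborel)"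
    using Dw_le by (intro nn_integral_mono_AE) (auto intro: ennreal_leI)
  also have "\<dots> = ennreal (\<integral>x. C / 2 * ?f x + real q * ?g x \<partial>lborel)"
    using intf intg C_nonneg by (intro nn_integral_eq_integral) auto
  also have "(\<integral>x. C / 2 * ?f x + real q * ?g x \<partial>lborel) = C / 2 * moment q \<phi> + real q * (\<integral>x. ?g x \<partial>lborel)"
    using intf intg by (subst Bochner_Integration.integral_add) (auto simp only: moment_def integrable_mult_right integral_mult_right_zero)
  finally have Dw1: "(\<integral>\<^sup>+x. ennreal (norm (Dw x)) \<partial>lborel) \<le> ennreal (C / 2 * moment q \<phi> + real q * (\<integral>x. ?g x \<partial>lborel))" .
  have w2: "(w x)\<^sup>2 = V x * \<bar>\<phi> x\<bar> ^ (2 * q)" for x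
  proof -
    have "\<bar>\<phi> x\<bar> ^ (2 * q) = (\<bar>\<phi> x\<bar> ^ q)\<^sup>2" by (simp only: mult.commute[of 2] power_mult)
    also have "\<dots> = (\<phi> x ^ q)\<^sup>2" by (simp flip: power_abs)
    finally show ?thesis by (simp add: w_def power_mult_distrib)
  qed
  have "ennreal (moment (2 * q) \<phi>) = (\<integral>\<^sup>+x. ennreal ((w x)\<^sup>2) \<partial>lborel)"
    unfolding moment_def w2 using q by (intro nn_integral_eq_integral[symmetric] test_moment_integrable \<phi>) auto
  also have "\<dots> \<le> (\<integral>\<^sup>+x. ennreal (norm (Dw x)) \<partial>lborel)\<^sup>2"
    using q by (intro Gagliardo_Nirenberg_plane[OF der Dw_cont, where R = R]) (simp add: w_def R)
  also have "\<dots> \<le> (ennreal (C / 2 * moment q \<phi> + real q * (\<integral>x. ?g x \<partial>lborel)))\<^sup>2"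
    by (intro power_mono Dw1) auto
  also have "\<dots> = ennreal ((C / 2 * moment q \<phi> + real q * (\<integral>x. ?g x \<partial>lborel))\<^sup>2)"
    using nonneg C_nonneg by (intro ennreal_power) (auto intro!: add_nonneg_nonneg mult_nonneg_nonneg)
  finally have "moment (2 * q) \<phi> \<le> (C / 2 * moment q \<phi> + real q * (\<integral>x. ?g x \<partial>lborel))\<^sup>2" by simp
  also have "\<dots> \<le> (C / 2 * moment q \<phi>
      + real q * sqrt (moment (2 * q - 2) \<phi> * (\<integral>x. (norm (grad \<phi> x))\<^sup>2 \<partial>lborel)))\<^sup>2"
    using CS nonneg C_nonneg by (intro power_mono add_left_mono mult_left_mono add_nonneg_nonneg mult_nonneg_nonneg) auto
  finally show ?thesis .
qed

text \<open>The step with q = k + 1 leads from exponent 2k to 2k + 2, and the moment of order k + 1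
  is interpolated between orders 2 and 2k.\<close>

lemma test_moment_bound:
  assumes K: "K \<ge> 0" and "k \<ge> 1"
  shows "\<exists>D\<ge>0. \<forall>\<phi>\<in>test_fun. normV_sq V (test_pair \<phi>) \<le> K \<longrightarrow> moment (2 * k) \<phi> \<le> D * normV_sq V (test_pair \<phi>)"
  using \<open>k \<ge> 1\<close>
proof (induct k rule: dec_induct)
  case base
  have "moment 2 \<phi> \<le> normV_sq V (test_pair \<phi>)" if "\<phi> \<in> test_fun" for \<phi>
    unfolding test_normV_sq[OF that] by (simp add: integral_nonneg_AE)
  then show ?case by (intro exI[of _ 1]) auto
next
  case (step k)
  then obtain D where D: "D \<ge> 0" and IH: "\<And>\<phi>. \<phi> \<in> test_fun \<Longrightarrow> normV_sq V (test_pair \<phi>) \<le> K \<Longrightarrow>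
      moment (2 * k) \<phi> \<le> D * normV_sq V (test_pair \<phi>)" by blast
  \<comment> \<open>Here \<open>1 + D\<close> comes from the interpolated moment and
    \<open>sqrt D\<close> from the Cauchy-Schwarz term, so that \<open>B * N\<close> bounds the L1
    norm of the gradient.\<close>
  define B where "B = C / 2 * (1 + D) + real (Suc k) * sqrt D"
  have B: "B \<ge> 0" using C_nonneg D by (simp add: B_def)
  have "moment (2 * Suc k) \<phi> \<le> B\<^sup>2 * K * normV_sq V (test_pair \<phi>)"
    if \<phi>: "\<phi> \<in> test_fun" and le: "normV_sq V (test_pair \<phi>) \<le> K" for \<phi>
  proof -
    define N where "N = normV_sq V (test_pair \<phi>)"
    define G where "G = (\<integral>x. (norm (grad \<phi> x))\<^sup>2 \<partial>lborel)"
    have N: "N \<ge> 0" by (simp add: N_def normV_sq_eq L2_inner_self_nonneg)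
    have mom: "0 \<le> moment m \<phi>" for m by (auto simp: moment_def intro!: integral_nonneg_AE)
    have G: "0 \<le> G" "G \<le> N" and m2: "moment 2 \<phi> \<le> N"
      unfolding N_def G_def test_normV_sq[OF \<phi>] using mom[of 2] by (auto intro!: integral_nonneg_AE)
    have mk: "moment (2 * k) \<phi> \<le> D * N" using IH[OF \<phi> le] by (simp add: N_def)
    have "moment (Suc k) \<phi> \<le> (\<integral>x. V x * \<bar>\<phi> x\<bar> ^ 2 + V x * \<bar>\<phi> x\<bar> ^ (2 * k) \<partial>lborel)"
      unfolding moment_def
    proof (rule integral_mono[OF test_moment_integrable[OF \<phi>] Bochner_Integration.integrable_add[OF
            test_moment_integrable[OF \<phi>] test_moment_integrable[OF \<phi>]]])
      show "V x * \<bar>\<phi> x\<bar> ^ Suc k \<le> V x * \<bar>\<phi> x\<bar> ^ 2 + V x * \<bar>\<phi> x\<bar> ^ (2 * k)" for x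
        using power_le_sum_powers[of "\<bar>\<phi> x\<bar>" "Suc k" "2 * k"] \<open>1 \<le> k\<close> mult_left_mono[OF _ V_nonneg[of x]]
        unfolding distrib_left[symmetric] by simp
    qed (use \<open>1 \<le> k\<close> in auto)
    also have "\<dots> = moment 2 \<phi> + moment (2 * k) \<phi>"
      unfolding moment_def using \<open>1 \<le> k\<close>
      by (intro Bochner_Integration.integral_add test_moment_integrable[OF \<phi>]) auto
    finally have mS: "moment (Suc k) \<phi> \<le> (1 + D) * N" using m2 mk by (simp add: algebra_simps)
    have "sqrt (moment (2 * k) \<phi> * G) \<le> sqrt ((D * N) * N)"
      using mk G N D mom by (intro real_sqrt_le_mono mult_mono) auto
    also have "\<dots> = sqrt D * N" using N by (simp add: real_sqrt_mult)
    finally have sq: "sqrt (moment (2 * k) \<phi> * G) \<le> sqrt D * N" .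
    have "moment (2 * Suc k) \<phi> \<le> (C / 2 * moment (Suc k) \<phi> + real (Suc k) * sqrt (moment (2 * k) \<phi> * G))\<^sup>2"
      using test_moment_step[OF \<phi>, of "Suc k"] \<open>1 \<le> k\<close> by (simp add: G_def)
    also have "\<dots> \<le> (C / 2 * ((1 + D) * N) + real (Suc k) * (sqrt D * N))\<^sup>2"
      using mS sq C_nonneg mom G
      by (intro power_mono add_mono mult_left_mono add_nonneg_nonneg mult_nonneg_nonneg) auto
    also have "C / 2 * ((1 + D) * N) + real (Suc k) * (sqrt D * N) = B * N"
      unfolding B_def by (simp add: algebra_simps)
    also have "(B * N)\<^sup>2 = B\<^sup>2 * N * N" by (simp add: power2_eq_square)
    \<comment> \<open>Only one of the two factors \<open>N\<close> is replaced by \<open>K\<close>;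
      the other keeps the bound linear.\<close>
    also have "\<dots> \<le> B\<^sup>2 * K * N" using le N by (intro mult_right_mono mult_left_mono) (auto simp: N_def)
    finally show ?thesis by (simp add: N_def)
  qed
  then show ?case using K by (intro exI[of _ "B\<^sup>2 * K"]) auto
qed

lemma H1V_moment_bound:
  assumes K: "K \<ge> 0" and k: "k \<ge> 1"
  shows "\<exists>D\<ge>0. \<forall>v\<in>H1V V. 0 < normV_sq V v \<and> normV_sq V v \<le> K \<longrightarrow>
    (\<integral>\<^sup>+x. ennreal (V x * \<bar>fst v x\<bar> ^ (2 * k)) \<partial>lborel) \<le> ennreal (D * normV_sq V v)"
proof -
  \<comment> \<open>\<open>3 * K\<close>, because the approximating test functions may have up to
    three times the squared norm of \<open>v\<close>.\<close>
  obtain D where D: "D \<ge> 0" and Db: "\<And>\<phi>. \<phi> \<in> test_fun \<Longrightarrow> normV_sq V (test_pair \<phi>) \<le> 3 * K \<Longrightarrow>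
      moment (2 * k) \<phi> \<le> D * normV_sq V (test_pair \<phi>)"
    using test_moment_bound[of "3 * K" k] K k by auto
  have "(\<integral>\<^sup>+x. ennreal (V x * \<bar>fst v x\<bar> ^ (2 * k)) \<partial>lborel) \<le> ennreal (3 * D * normV_sq V v)"
    if v: "v \<in> H1V V" and pos: "0 < normV_sq V v" and le: "normV_sq V v \<le> K" for v
  proof -
    obtain \<phi> where \<phi>: "\<And>n. \<phi> n \<in> test_fun"
      and N: "\<And>n. normV_sq V (test_pair (\<phi> n)) \<le> 3 * normV_sq V v"
      and ae: "AE x in lborel. (\<lambda>n. \<phi> n x) \<longlonglongrightarrow> fst v x"
      using H1V_test_sequence[OF v pos] by blast
    have [measurable]: "\<phi> n \<in> borel_measurable borel" for n
      using test_fun_continuous[OF \<phi>] by (rule borel_measurable_continuous_onI)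
    have conv: "AE x in lborel. (\<lambda>n. V x * \<bar>\<phi> n x\<bar> ^ (2 * k)) \<longlonglongrightarrow> V x * \<bar>fst v x\<bar> ^ (2 * k)"
      using ae by eventually_elim (intro tendsto_intros)
    have "(\<integral>\<^sup>+x. ennreal (V x * \<bar>\<phi> n x\<bar> ^ (2 * k)) \<partial>lborel) \<le> ennreal (3 * D * normV_sq V v)" for n
    proof -
      have "(\<integral>\<^sup>+x. ennreal (V x * \<bar>\<phi> n x\<bar> ^ (2 * k)) \<partial>lborel) = ennreal (moment (2 * k) (\<phi> n))"
        unfolding moment_def using k by (intro nn_integral_eq_integral test_moment_integrable \<phi>) auto
      moreover have "moment (2 * k) (\<phi> n) \<le> D * normV_sq V (test_pair (\<phi> n))"
        using N[of n] le by (intro Db \<phi>) linarith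
      moreover have "D * normV_sq V (test_pair (\<phi> n)) \<le> D * (3 * normV_sq V v)"
        using N D by (rule mult_left_mono)
      ultimately show ?thesis by (simp add: ac_simps ennreal_leI)
    qed
    then have "\<forall>\<^sub>F n in sequentially.
        (\<integral>\<^sup>+x. ennreal (V x * \<bar>\<phi> n x\<bar> ^ (2 * k)) \<partial>lborel) \<le> ennreal (3 * D * normV_sq V v)" by simp
    then show ?thesis by (intro nn_integral_le_of_AE_limit[OF _ conv]) measurable
  qed
  then show ?thesis using D by (intro exI[of _ "3 * D"]) auto
qed

text \<open>The real exponent p + 1 lies between 2 and an even integer; the norm controls the lower
  end and an even moment the upper one.\<close>

lemma nonlin_bound:
  assumes K: "K \<ge> 0" and p: "p \<ge> 1"
  shows "\<exists>D\<ge>0. \<forall>v\<in>H1V V. 0 < normV_sq V v \<and> normV_sq V v \<le> K \<longrightarrow> nonlin p V (fst v) \<le> D * normV_sq V v"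
proof -
  obtain k :: nat where k: "p + 1 \<le> real k" using real_arch_simple by blast
  then have k1: "k \<ge> 1" using p by linarith
  obtain D where D: "D \<ge> 0" and Db: "\<And>v. v \<in> H1V V \<Longrightarrow> 0 < normV_sq V v \<Longrightarrow> normV_sq V v \<le> K \<Longrightarrow>
    (\<integral>\<^sup>+x. ennreal (V x * \<bar>fst v x\<bar> ^ (2 * k)) \<partial>lborel) \<le> ennreal (D * normV_sq V v)"
    using H1V_moment_bound[OF K k1] by blast
  have "nonlin p V (fst v) \<le> (1 + D) * normV_sq V v"
    if v: "v \<in> H1V V" and pos: "0 < normV_sq V v" and le: "normV_sq V v \<le> K" for v
  proof -
    have [measurable]: "fst v \<in> borel_measurable lborel" "E v \<in> borel_measurable lborel"
      using v L2_measurable[OF H1V_L2[OF v]] unfolding H1V_iff by blast+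
    have "(\<integral>\<^sup>+x. ennreal (V x * \<bar>fst v x\<bar> powr (p + 1)) \<partial>lborel)
        \<le> (\<integral>\<^sup>+x. ennreal ((norm (E v x))\<^sup>2) + ennreal (V x * \<bar>fst v x\<bar> ^ (2 * k)) \<partial>lborel)"
    proof (rule nn_integral_mono)
      fix x
      have "V x * \<bar>fst v x\<bar> powr (p + 1) \<le> V x * (\<bar>fst v x\<bar>\<^sup>2 + \<bar>fst v x\<bar> ^ (2 * k))"
        using p k by (intro mult_left_mono powr_le_sum_powers) auto
      also have "\<dots> \<le> (norm (E v x))\<^sup>2 + V x * \<bar>fst v x\<bar> ^ (2 * k)" by (simp add: norm_E distrib_left)
      finally show "ennreal (V x * \<bar>fst v x\<bar> powr (p + 1)) \<le> ennreal ((norm (E v x))\<^sup>2) + ennreal (V x * \<bar>fst v x\<bar> ^ (2 * k))"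
        by (simp add: ennreal_leI flip: ennreal_plus)
    qed
    also have "\<dots> = (\<integral>\<^sup>+x. ennreal ((norm (E v x))\<^sup>2) \<partial>lborel) + (\<integral>\<^sup>+x. ennreal (V x * \<bar>fst v x\<bar> ^ (2 * k)) \<partial>lborel)"
      by (intro nn_integral_add) measurable
    also have "\<dots> \<le> ennreal (normV_sq V v) + ennreal (D * normV_sq V v)"
      using Db[OF v pos le] by (simp add: nn_integral_L2[OF H1V_L2[OF v]] normV_sq_eq)
    also have "\<dots> = ennreal ((1 + D) * normV_sq V v)"
      using pos D by (simp add: distrib_right flip: ennreal_plus)
    finally have *: "(\<integral>\<^sup>+x. ennreal (V x * \<bar>fst v x\<bar> powr (p + 1)) \<partial>lborel) \<le> ennreal ((1 + D) * normV_sq V v)" .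
    have "nonlin p V (fst v) = enn2real (\<integral>\<^sup>+x. ennreal (V x * \<bar>fst v x\<bar> powr (p + 1)) \<partial>lborel)"
      unfolding nonlin_def by (rule integral_eq_nn_integral) auto
    also have "\<dots> \<le> (1 + D) * normV_sq V v"
      using enn2real_mono[OF *] pos D by simp
    finally show ?thesis .
  qed
  then show ?thesis using D by (intro exI[of _ "1 + D"]) auto
qed

end

section \<open>Translations and ball averages\<close>

lemma nn_integral_lborel_shift:
  fixes f :: "'a::euclidean_space \<Rightarrow> ennreal"
  assumes "f \<in> borel_measurable borel"
  shows "(\<integral>\<^sup>+x. f (c + x) \<partial>lborel) = (\<integral>\<^sup>+x. f x \<partial>lborel)"
  using nn_integral_distr[of "(+) c" lborel borel f] assms by (simp add: lborel_distr_plus)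

lemma integral_lborel_shift:
  fixes f :: "'a::euclidean_space \<Rightarrow> real"
  assumes "f \<in> borel_measurable borel"
  shows "(\<integral>x. f (c + x) \<partial>lborel) = (\<integral>x. f x \<partial>lborel)"
  using integral_distr[of "(+) c" lborel borel f] assms by (simp add: lborel_distr_plus)

lemma integrable_lborel_shift:
  fixes f :: "'a::euclidean_space \<Rightarrow> real"
  assumes "integrable lborel f"
  shows "integrable lborel (\<lambda>x. f (c + x))"
  using integrable_distr[of "(+) c" lborel borel f] assms by (simp add: lborel_distr_plus)

lemma AE_lborel_shift:
  fixes c :: "'a::euclidean_space"
  assumes "AE x in lborel. P x"
  shows "AE x in lborel. P (c + x)"
  using AE_distrD[of "(+) c" lborel borel P] assms unfolding lborel_distr_plus by simp

text \<open>The derivative is integrated along the segment from \<open>x\<close> to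
  \<open>z + x\<close>; Cauchy-Schwarz against the constant 1 on the unit interval moves the square
  inside the integral.\<close>

lemma test_fun_translation_pointwise:
  assumes \<phi>: "\<phi> \<in> test_fun"
  shows "ennreal ((\<phi> (z + x) - \<phi> x)\<^sup>2)
    \<le> (\<integral>\<^sup>+t. ennreal ((norm z)\<^sup>2 * (norm (grad \<phi> (t *\<^sub>R z + x)))\<^sup>2) * indicator {0..1} t \<partial>lborel)"
proof -
  note cont = test_fun_continuous_grad[OF \<phi>]
  have [measurable]: "grad \<phi> \<in> borel_measurable borel" using cont by (rule borel_measurable_continuous_onI)
  have "((\<lambda>t. \<phi> (t *\<^sub>R z + x)) has_derivative (\<lambda>h. grad \<phi> (t *\<^sub>R z + x) \<bullet> (h *\<^sub>R z))) (at t)" for t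
  proof -
    have "((\<lambda>t. t *\<^sub>R z + x) has_derivative (\<lambda>h. h *\<^sub>R z)) (at t)"
      by (auto intro!: derivative_eq_intros)
    from has_derivative_compose[OF this test_fun_has_derivative[OF \<phi>]] show ?thesis by simp
  qed
  then have "((\<lambda>t. \<phi> (t *\<^sub>R z + x)) has_real_derivative (grad \<phi> (t *\<^sub>R z + x) \<bullet> z)) (at t)" for t
    unfolding has_field_derivative_def by (rule has_derivative_eq_rhs) (simp add: fun_eq_iff)
  moreover have "continuous_on UNIV (\<lambda>t. grad \<phi> (t *\<^sub>R z + x) \<bullet> z)"
    by (intro continuous_intros continuous_on_compose2[OF cont]) auto
  ultimately have "ennreal \<bar>\<phi> (1 *\<^sub>R z + x) - \<phi> (0 *\<^sub>R z + x)\<bar>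
      \<le> (\<integral>\<^sup>+t. ennreal \<bar>grad \<phi> (t *\<^sub>R z + x) \<bullet> z\<bar> * indicator {0..1} t \<partial>lborel)"
    by (intro abs_diff_le_nn_integral_deriv) auto
  \<comment> \<open>The indicator is written twice, once for each factor of Cauchy-Schwarz.\<close>
  also have "\<dots> \<le> (\<integral>\<^sup>+t. (ennreal (norm z * norm (grad \<phi> (t *\<^sub>R z + x))) * indicator {0..1} t) * indicator {0..1} t \<partial>lborel)"
  proof (intro nn_integral_mono)
    fix t
    have "\<bar>grad \<phi> (t *\<^sub>R z + x) \<bullet> z\<bar> \<le> norm z * norm (grad \<phi> (t *\<^sub>R z + x))"
      using Cauchy_Schwarz_ineq2[of "grad \<phi> (t *\<^sub>R z + x)" z] by (simp add: mult.commute)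
    then show "ennreal \<bar>grad \<phi> (t *\<^sub>R z + x) \<bullet> z\<bar> * indicator {0..1} t
        \<le> (ennreal (norm z * norm (grad \<phi> (t *\<^sub>R z + x))) * indicator {0..1} t) * indicator {0..1} t"
      by (auto simp: indicator_def intro!: ennreal_leI)
  qed
  finally have "(ennreal \<bar>\<phi> (z + x) - \<phi> x\<bar>)\<^sup>2 \<le> (\<integral>\<^sup>+t. (ennreal (norm z * norm (grad \<phi> (t *\<^sub>R z + x))) * indicator {0..1} t) * indicator {0..1} t \<partial>lborel)\<^sup>2"
    by (intro power_mono) auto
  also have "\<dots> \<le> (\<integral>\<^sup>+t. (ennreal (norm z * norm (grad \<phi> (t *\<^sub>R z + x))) * indicator {0..1} t)\<^sup>2 \<partial>lborel)
      * (\<integral>\<^sup>+t. (indicator {0..1::real} t)\<^sup>2 \<partial>lborel)"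
    by (rule Cauchy_Schwarz_nn_integral) measurable
  also have "(\<integral>\<^sup>+t. (indicator {0..1::real} t :: ennreal)\<^sup>2 \<partial>lborel) = (\<integral>\<^sup>+t. indicator {0..1::real} t \<partial>lborel)"
    by (intro nn_integral_cong) (auto simp: indicator_def)
  also have "\<dots> = 1" by simp
  also have "(\<integral>\<^sup>+t. (ennreal (norm z * norm (grad \<phi> (t *\<^sub>R z + x))) * indicator {0..1} t)\<^sup>2 \<partial>lborel) * 1
      = (\<integral>\<^sup>+t. ennreal ((norm z)\<^sup>2 * (norm (grad \<phi> (t *\<^sub>R z + x)))\<^sup>2) * indicator {0..1} t \<partial>lborel)"
    by (simp only: mult_1_right, intro nn_integral_cong)
      (auto simp: indicator_def ennreal_power power_mult_distrib)
  finally show ?thesis by (simp add: ennreal_power)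
qed

text \<open>After the integrals are exchanged, translation invariance makes every \<open>t\<close>
  in the unit interval contribute the same amount.\<close>

lemma test_fun_translation:
  assumes \<phi>: "\<phi> \<in> test_fun"
  shows "(\<integral>\<^sup>+x. ennreal ((\<phi> (z + x) - \<phi> x)\<^sup>2) \<partial>lborel)
    \<le> ennreal ((norm z)\<^sup>2) * (\<integral>\<^sup>+x. ennreal ((norm (grad \<phi> x))\<^sup>2) \<partial>lborel)"
proof -
  have [measurable]: "grad \<phi> \<in> borel_measurable borel"
    using test_fun_continuous_grad[OF \<phi>] by (rule borel_measurable_continuous_onI)
  let ?h = "\<lambda>x. ennreal ((norm z)\<^sup>2 * (norm (grad \<phi> x))\<^sup>2)"
  have "(\<integral>\<^sup>+x. ennreal ((\<phi> (z + x) - \<phi> x)\<^sup>2) \<partial>lborel)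
      \<le> (\<integral>\<^sup>+x. \<integral>\<^sup>+t. ?h (t *\<^sub>R z + x) * indicator {0..1} t \<partial>lborel \<partial>lborel)"
    by (intro nn_integral_mono test_fun_translation_pointwise \<phi>)
  also have "\<dots> = (\<integral>\<^sup>+t. \<integral>\<^sup>+x. ?h (t *\<^sub>R z + x) * indicator {0..1} t \<partial>lborel \<partial>lborel)"
    by (rule lborel_pair.Fubini') measurable
  also have "\<dots> = (\<integral>\<^sup>+t. (\<integral>\<^sup>+x. ?h x \<partial>lborel) * indicator {0..1::real} t \<partial>lborel)"
  proof (intro nn_integral_cong)
    fix t :: real
    have "(\<integral>\<^sup>+x. ?h (t *\<^sub>R z + x) * indicator {0..1} t \<partial>lborel) = (\<integral>\<^sup>+x. ?h (t *\<^sub>R z + x) \<partial>lborel) * indicator {0..1} t"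
      by (rule nn_integral_multc) measurable
    also have "(\<integral>\<^sup>+x. ?h (t *\<^sub>R z + x) \<partial>lborel) = (\<integral>\<^sup>+x. ?h x \<partial>lborel)"
      by (rule nn_integral_lborel_shift) measurable
    finally show "(\<integral>\<^sup>+x. ?h (t *\<^sub>R z + x) * indicator {0..1} t \<partial>lborel) = (\<integral>\<^sup>+x. ?h x \<partial>lborel) * indicator {0..1} t" .
  qed
  also have "\<dots> = (\<integral>\<^sup>+x. ?h x \<partial>lborel)" by (simp add: nn_integral_cmult)
  also have "\<dots> = ennreal ((norm z)\<^sup>2) * (\<integral>\<^sup>+x. ennreal ((norm (grad \<phi> x))\<^sup>2) \<partial>lborel)"
    by (simp add: ennreal_mult nn_integral_cmult)
  finally show ?thesis .
qed

text \<open>The rate |z|^2 is uniform on bounded sets of \<open>H1V\<close>, so one small radius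
  will serve all members of the sequence at once.\<close>

lemma (in positive_potential) H1V_translation:
  assumes v: "v \<in> H1V V" and pos: "0 < normV_sq V v"
  shows "(\<integral>\<^sup>+x. ennreal ((fst v (z + x) - fst v x)\<^sup>2) \<partial>lborel) \<le> ennreal ((norm z)\<^sup>2 * (3 * normV_sq V v))"
proof -
  obtain \<phi> where \<phi>: "\<And>n. \<phi> n \<in> test_fun"
    and N: "\<And>n. normV_sq V (test_pair (\<phi> n)) \<le> 3 * normV_sq V v"
    and ae: "AE x in lborel. (\<lambda>n. \<phi> n x) \<longlonglongrightarrow> fst v x"
    using H1V_test_sequence[OF v pos] by blast
  have [measurable]: "\<phi> n \<in> borel_measurable borel" for n
    using test_fun_continuous[OF \<phi>] by (rule borel_measurable_continuous_onI)
  have conv: "AE x in lborel. (\<lambda>n. (\<phi> n (z + x) - \<phi> n x)\<^sup>2) \<longlonglongrightarrow> (fst v (z + x) - fst v x)\<^sup>2"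
    using ae AE_lborel_shift[OF ae, of z] by eventually_elim (intro tendsto_intros)
  have "(\<integral>\<^sup>+x. ennreal ((\<phi> n (z + x) - \<phi> n x)\<^sup>2) \<partial>lborel) \<le> ennreal ((norm z)\<^sup>2 * (3 * normV_sq V v))" for n
  proof -
    have "(\<integral>\<^sup>+x. ennreal ((norm (grad (\<phi> n) x))\<^sup>2) \<partial>lborel) \<le> (\<integral>\<^sup>+x. ennreal ((norm (E (test_pair (\<phi> n)) x))\<^sup>2) \<partial>lborel)"
      by (intro nn_integral_mono ennreal_leI) (simp add: norm_E)
    also have "\<dots> = ennreal (normV_sq V (test_pair (\<phi> n)))"
      by (simp add: nn_integral_L2[OF test_E_L2[OF \<phi>]] normV_sq_eq)
    also have "\<dots> \<le> ennreal (3 * normV_sq V v)" by (intro ennreal_leI N)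
    finally have "ennreal ((norm z)\<^sup>2) * (\<integral>\<^sup>+x. ennreal ((norm (grad (\<phi> n) x))\<^sup>2) \<partial>lborel)
        \<le> ennreal ((norm z)\<^sup>2) * ennreal (3 * normV_sq V v)" by (rule mult_left_mono) simp
    also have "\<dots> = ennreal ((norm z)\<^sup>2 * (3 * normV_sq V v))" using pos by (subst ennreal_mult) auto
    finally show ?thesis using test_fun_translation[OF \<phi>, of n z] by (rule order.trans[rotated])
  qed
  then have "\<forall>\<^sub>F n in sequentially.
    (\<integral>\<^sup>+x. ennreal ((\<phi> n (z + x) - \<phi> n x)\<^sup>2) \<partial>lborel) \<le> ennreal ((norm z)\<^sup>2 * (3 * normV_sq V v))" by simp
  then show ?thesis by (intro nn_integral_le_of_AE_limit[OF _ conv]) measurable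
qed

section \<open>Averages over small balls\<close>

definition ball_average :: "real \<Rightarrow> ('a::euclidean_space \<Rightarrow> real) \<Rightarrow> 'a \<Rightarrow> real" where
  "ball_average h u x = (\<integral>y. indicator (cball x h) y * u y \<partial>lborel) / measure lborel (cball (0::'a) h)"

lemma indicator_cball_shift: "indicator (cball x h) (x + z) = (indicator (cball 0 h) z :: real)" for x z :: "'a::euclidean_space"
  by (simp add: indicator_def dist_norm)

lemma L2_indicator_mult:
  assumes "F \<in> L2_space M" "A \<in> sets M"
  shows "(\<lambda>x. indicator A x *\<^sub>R F x) \<in> L2_space M"
proof -
  have [measurable]: "F \<in> borel_measurable M" "A \<in> sets M" using assms L2_measurable by auto
  have "integrable M (\<lambda>x. (norm (indicator A x *\<^sub>R F x))\<^sup>2)"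
    by (rule Bochner_Integration.integrable_bound[of _ "\<lambda>x. (norm (F x))\<^sup>2"])
      (use assms in \<open>auto simp: L2_space_def indicator_def\<close>)
  then show ?thesis by (simp add: L2_space_def)
qed

lemma L2_indicator:
  assumes "A \<in> sets M" "emeasure M A < \<infinity>"
  shows "(indicator A :: _ \<Rightarrow> real) \<in> L2_space M"
proof -
  have "(\<lambda>x. (norm (indicator A x :: real))\<^sup>2) = indicator A" by (auto simp: indicator_def)
  then show ?thesis using assms by (auto simp: L2_space_def)
qed

lemma L2_inner_indicator: "A \<in> sets M \<Longrightarrow> emeasure M A < \<infinity> \<Longrightarrow> L2_inner M (indicator A) (indicator A :: _ \<Rightarrow> real) = measure M A"
proof -
  assume A: "A \<in> sets M" "emeasure M A < \<infinity>"
  have "(\<lambda>x. (norm (indicator A x :: real))\<^sup>2) = indicator A" by (auto simp: indicator_def)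
  then show ?thesis using A by (simp add: L2_inner_self)
qed

text \<open>The value is the average plus a deviation, and by Cauchy-Schwarz on the ball the squared
  deviation is at most the mean of the squared increments.\<close>

lemma sq_le_ball_average:
  fixes u :: "'a::euclidean_space \<Rightarrow> real"
  assumes u: "u \<in> L2_space lborel" and h: "h > 0"
  shows "ennreal ((u x)\<^sup>2) \<le> ennreal (2 * (ball_average h u x)\<^sup>2)
    + ennreal (2 / measure lborel (cball (0::'a) h)) *
      (\<integral>\<^sup>+z. ennreal ((u (z + x) - u x)\<^sup>2) * indicator (cball 0 h) z \<partial>lborel)"
proof -
  define S where "S = cball (0::'a) h"
  define c where "c = measure lborel S"
  have c: "c > 0" unfolding c_def S_def using content_cball_pos[OF h] by simp
  have S: "S \<in> sets lborel" "emeasure lborel S < \<infinity>" using emeasure_lborel_cball_finite[of 0 h] by (auto simp: S_def)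
  have [measurable]: "u \<in> borel_measurable borel" using L2_measurable[OF u] by simp
  have sh: "(\<lambda>z. u (x + z)) \<in> L2_space lborel"
    using u integrable_lborel_shift[of "\<lambda>y. (u y)\<^sup>2" x] by (simp add: L2_space_def)
  \<comment> \<open>Pairing \<open>d\<close> with the indicator of the ball gives the average minus
    \<open>u x\<close>, times the volume.\<close>
  define d where "d z = indicator S z *\<^sub>R u (x + z) - u x *\<^sub>R indicator S z" for z
  have d: "d \<in> L2_space lborel"
    unfolding d_def by (intro L2_diff L2_indicator_mult L2_scale L2_indicator S sh)
  have "ball_average h u x * c = (\<integral>y. indicator (cball x h) y * u y \<partial>lborel)"
    using c by (simp add: ball_average_def c_def S_def)
  also have "\<dots> = (\<integral>z. indicator (cball x h) (x + z) * u (x + z) \<partial>lborel)"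
    by (intro integral_lborel_shift[symmetric] borel_measurable_times borel_measurable_indicator) auto
  also have "\<dots> = L2_inner lborel (\<lambda>z. indicator S z *\<^sub>R u (x + z)) (indicator S)"
    unfolding L2_inner_def indicator_cball_shift S_def by (intro Bochner_Integration.integral_cong) (auto simp: indicator_def)
  finally have avg: "L2_inner lborel (\<lambda>z. indicator S z *\<^sub>R u (x + z)) (indicator S) = ball_average h u x * c" ..
  have "L2_inner lborel d (indicator S) = (ball_average h u x - u x) * c"
    unfolding d_def
    by (subst L2_inner_diff_left[OF L2_indicator_mult[OF sh S(1)] L2_scale[OF L2_indicator[OF S]] L2_indicator[OF S]])
      (simp add: avg L2_inner_scale_left L2_inner_indicator[OF S] c_def[symmetric] left_diff_distrib del: real_scaleR_def)
  then have "((ball_average h u x - u x) * c)\<^sup>2 \<le> L2_inner lborel d d * c"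
    using L2_Cauchy_Schwarz[OF d L2_indicator[OF S]] by (simp add: L2_inner_indicator[OF S] c_def)
  then have "(ball_average h u x - u x)\<^sup>2 * c * c \<le> L2_inner lborel d d * c"
    by (simp add: power_mult_distrib power2_eq_square ac_simps)
  then have "(ball_average h u x - u x)\<^sup>2 * c \<le> L2_inner lborel d d" using c by simp
  then have "(ball_average h u x - u x)\<^sup>2 \<le> L2_inner lborel d d / c" using c by (simp add: field_simps)
  moreover have "(u x)\<^sup>2 \<le> 2 * (ball_average h u x)\<^sup>2 + 2 * (ball_average h u x - u x)\<^sup>2"
    using norm_add_sq_le[of "ball_average h u x" "u x - ball_average h u x"] by (simp add: power2_commute)
  ultimately have "(u x)\<^sup>2 \<le> 2 * (ball_average h u x)\<^sup>2 + (2 / c) * L2_inner lborel d d" by simp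
  then have "ennreal ((u x)\<^sup>2) \<le> ennreal (2 * (ball_average h u x)\<^sup>2 + (2 / c) * L2_inner lborel d d)"
    by (rule ennreal_leI)
  also have "\<dots> = ennreal (2 * (ball_average h u x)\<^sup>2) + ennreal (2 / c) * ennreal (L2_inner lborel d d)"
  proof -
    have "ennreal ((2 / c) * L2_inner lborel d d) = ennreal (2 / c) * ennreal (L2_inner lborel d d)"
      using c by (intro ennreal_mult L2_inner_self_nonneg) simp
    moreover have "0 \<le> (2 / c) * L2_inner lborel d d"
      using c by (intro mult_nonneg_nonneg L2_inner_self_nonneg) simp
    ultimately show ?thesis by (simp only: ennreal_plus mult_nonneg_nonneg zero_le_power2 zero_le_numeral)
  qed
  also have "ennreal (L2_inner lborel d d) = (\<integral>\<^sup>+z. ennreal ((norm (d z))\<^sup>2) \<partial>lborel)"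
    by (rule nn_integral_L2[OF d, symmetric])
  also have "\<dots> = (\<integral>\<^sup>+z. ennreal ((u (z + x) - u x)\<^sup>2) * indicator S z \<partial>lborel)"
    by (intro nn_integral_cong) (auto simp: d_def indicator_def add.commute)
  finally show ?thesis by (simp add: c_def S_def)
qed

lemma cball_in_sets_borel [measurable]: "cball x h \<in> sets borel"
  by simp

text \<open>Writing the indicator through \<open>dist x y\<close> exposes joint measurability in the
  centre and the integration variable.\<close>

lemma ball_average_measurable:
  fixes u :: "'a::euclidean_space \<Rightarrow> real"
  assumes [measurable]: "u \<in> borel_measurable borel"
  shows "ball_average h u \<in> borel_measurable borel"
proof -
  have "(\<lambda>x. \<integral>y. (if dist x y \<le> h then 1 else 0) * u y \<partial>lborel) \<in> borel_measurable borel"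
    by (rule lborel.borel_measurable_lebesgue_integral) measurable
  moreover have "indicator (cball x h) y = (if dist x y \<le> h then 1 else (0::real))" for x y :: 'a
    by (simp add: indicator_def)
  ultimately show ?thesis unfolding ball_average_def[abs_def] by simp
qed

text \<open>The bound is uniform in \<open>x\<close> and will supply the dominating function for
  pointwise convergent averages.\<close>

lemma ball_average_sq_le:
  fixes u :: "'a::euclidean_space \<Rightarrow> real"
  assumes u: "u \<in> L2_space lborel" and h: "h > 0"
  shows "(ball_average h u x)\<^sup>2 \<le> L2_inner lborel u u / measure lborel (cball (0::'a) h)"
proof -
  define c where "c = measure lborel (cball (0::'a) h)"
  have c: "c > 0" unfolding c_def using content_cball_pos[OF h] by simp
  have cx: "measure lborel (cball x h) = c" using h by (simp add: c_def content_cball)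
  have S: "cball x h \<in> sets lborel" "emeasure lborel (cball x h) < \<infinity>"
    using emeasure_lborel_cball_finite[of x h] by auto
  have "(ball_average h u x * c)\<^sup>2 = (L2_inner lborel (indicator (cball x h)) u)\<^sup>2"
    using c by (simp add: ball_average_def c_def L2_inner_def)
  also have "\<dots> \<le> c * L2_inner lborel u u"
    using L2_Cauchy_Schwarz[OF L2_indicator[OF S] u] by (simp add: L2_inner_indicator[OF S] cx)
  finally have "c * ((ball_average h u x)\<^sup>2 * c) \<le> c * L2_inner lborel u u"
    by (simp add: power_mult_distrib power2_eq_square ac_simps)
  then have "(ball_average h u x)\<^sup>2 * c \<le> L2_inner lborel u u" using c by simp
  then show ?thesis using c unfolding c_def[symmetric] by (simp add: field_simps)
qed

context positive_potential
begin

text \<open>Serves twice: with a global lower bound of \<open>V\<close> it gives plain L2 bounds,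
  and with a large bound valid far out it makes the tail small.\<close>

lemma fst_sq_le: "l > 0 \<Longrightarrow> l \<le> V x \<Longrightarrow> (fst v x)\<^sup>2 \<le> (1 / l) * (norm (E v x))\<^sup>2"
proof -
  assume l: "l > 0" "l \<le> V x"
  have "l * (fst v x)\<^sup>2 \<le> V x * (fst v x)\<^sup>2" using l by (intro mult_right_mono) auto
  also have "\<dots> \<le> (norm (E v x))\<^sup>2" by (simp add: norm_E)
  finally show ?thesis using l by (simp add: field_simps)
qed

lemma H1V_fst_L2:
  assumes \<delta>: "\<delta> > 0" "\<And>x. \<delta> \<le> V x" and v: "v \<in> H1V V"
  shows "fst v \<in> L2_space lborel" "L2_inner lborel (fst v) (fst v) \<le> normV_sq V v / \<delta>"
proof -
  have [measurable]: "fst v \<in> borel_measurable lborel" using v unfolding H1V_iff by blast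
  have int: "integrable lborel (\<lambda>x. (1 / \<delta>) * (norm (E v x))\<^sup>2)"
    using H1V_L2[OF v] by (auto simp: L2_space_def)
  have int2: "integrable lborel (\<lambda>x. (fst v x)\<^sup>2)"
    using fst_sq_le[OF \<delta>] \<delta>(1) by (intro Bochner_Integration.integrable_bound[OF int]) auto
  then show "fst v \<in> L2_space lborel" by (simp add: L2_space_def)
  have "L2_inner lborel (fst v) (fst v) = (\<integral>x. (fst v x)\<^sup>2 \<partial>lborel)" by (simp add: L2_inner_self)
  also have "\<dots> \<le> (\<integral>x. (1 / \<delta>) * (norm (E v x))\<^sup>2 \<partial>lborel)"
    by (intro integral_mono int int2 fst_sq_le \<delta>)
  also have "\<dots> = normV_sq V v / \<delta>" by (simp add: normV_sq_eq L2_inner_self)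
  finally show "L2_inner lborel (fst v) (fst v) \<le> normV_sq V v / \<delta>" .
qed

text \<open>Dividing by sqrt V undoes the weight, so the average at a fixed centre is a pairing to
  which weak convergence applies.\<close>

lemma ball_average_eq_inner:
  fixes x :: pt
  shows "ball_average h (fst v) x
    = L2_inner lborel (E v) (\<lambda>y. (indicator (cball x h) y / sqrt (V y), 0)) / measure lborel (cball (0::pt) h)"
proof -
  have "indicator (cball x h) y * fst v y = E v y \<bullet> (indicator (cball x h) y / sqrt (V y), 0)" for y
    using V_pos[of y] by (simp add: weighted_pair_def)
  then show ?thesis by (simp only: ball_average_def L2_inner_def)
qed

lemma weight_L2:
  assumes \<delta>: "\<delta> > 0" "\<And>x. \<delta> \<le> V x"
  shows "(\<lambda>y. (indicator (cball x h) y / sqrt (V y), 0)) \<in> L2E"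
proof -
  have "integrable lborel (\<lambda>y. indicator (cball x h) y / \<delta> :: real)"
    using emeasure_lborel_cball_finite[of x h] by auto
  then have "integrable lborel (\<lambda>y. indicator (cball x h) y / V y)"
  proof (rule Bochner_Integration.integrable_bound)
    have "1 / V y \<le> 1 / \<delta>" for y using \<delta> V_pos[of y] by (intro divide_left_mono) auto
    then show "AE y in lborel. norm (indicator (cball x h) y / V y) \<le> norm (indicator (cball x h) y / \<delta> :: real)"
      using \<delta>(1) by (intro AE_I2) (auto simp: indicator_def)
  qed measurable
  moreover have "(norm (indicator (cball x h) y / sqrt (V y), 0::pt))\<^sup>2 = indicator (cball x h) y / V y" for y
    by (simp add: norm_Pair power_divide indicator_def)
  moreover have "(\<lambda>y. (indicator (cball x h) y / sqrt (V y), 0::pt)) \<in> borel_measurable lborel"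
    by (intro borel_measurable_Pair) measurable
  ultimately show ?thesis by (simp add: L2_space_def)
qed

theorem weakly_null_imp_L2_null:
  assumes \<delta>: "\<delta> > 0" "\<And>x. \<delta> \<le> V x" and coercive: "filterlim V at_top at_infinity"
    and v: "\<And>n. v n \<in> H1V V" and pos: "\<And>n. 0 < normV_sq V (v n)" and K: "\<And>n. normV_sq V (v n) \<le> K"
    and weak: "\<And>w. w \<in> L2E \<Longrightarrow> (\<lambda>n. L2_inner lborel (E (v n)) w) \<longlonglongrightarrow> L2_inner lborel (E u0) w"
    and zero: "AE x in lborel. fst u0 x = 0"
  shows "(\<lambda>n. L2_sq (fst (v n))) \<longlonglongrightarrow> 0"
proof (rule LIMSEQ_I)
  fix e :: real assume e: "e > 0"
  have Kpos: "K > 0" using pos[of 0] K[of 0] by linarith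
  \<comment> \<open>Chosen so that the region where \<open>V\<close> is at least \<open>L\<close>
    contributes at most K / L = e / 4.\<close>
  define L where "L = 4 * K / e"
  have L: "L > 0" "K / L = e / 4" using e Kpos by (auto simp: L_def)
  obtain R where R: "\<And>x. norm x \<ge> R \<Longrightarrow> L \<le> V x"
    using coercive unfolding filterlim_at_top eventually_at_infinity by blast
  \<comment> \<open>Chosen so that the error of replacing functions by averages, which comes to 6
    h^2 K, equals e / 4; it does not depend on \<open>n\<close>.\<close>
  define h where "h = sqrt (e / (24 * K))"
  have h: "h > 0" "6 * h\<^sup>2 * K = e / 4" using e Kpos by (auto simp: h_def)
  define c where "c = measure lborel (cball (0::pt) h)"
  have c: "c > 0" unfolding c_def using content_cball_pos[OF h(1)] by simp
  have ec: "emeasure lborel (cball (0::pt) h) = ennreal c"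
    unfolding c_def using emeasure_lborel_cball_finite[of "0::pt" h] by (intro emeasure_eq_ennreal_measure) auto
  note fL2 = H1V_fst_L2[OF \<delta> v]
  have fm [measurable]: "fst (v n) \<in> borel_measurable borel" for n using L2_measurable[OF fL2(1)] by simp
  note [measurable] = ball_average_measurable
  let ?m = "\<lambda>n. ball_average h (fst (v n))"
  have avg0: "(\<lambda>n. ?m n x) \<longlonglongrightarrow> 0" for x
  proof -
    let ?w = "\<lambda>y. (indicator (cball x h) y / sqrt (V y), 0)"
    \<comment> \<open>The gradient part of \<open>?w\<close> is zero, so only the function part of
      \<open>u0\<close> enters, and that vanishes.\<close>
    have "L2_inner lborel (E u0) ?w = 0"
      unfolding L2_inner_def by (rule integral_eq_zero_AE) (use zero in \<open>auto simp: weighted_pair_def\<close>)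
    then have "(\<lambda>n. L2_inner lborel (E (v n)) ?w) \<longlonglongrightarrow> 0" using weak[OF weight_L2[OF \<delta>], of x h] by simp
    from tendsto_divide[OF this tendsto_const[of c]] c
    show ?thesis by (simp add: ball_average_eq_inner c_def)
  qed
  let ?B = "cball (0::pt) R"
  define J where "J n = (\<integral>x. indicator ?B x * (2 * (?m n x)\<^sup>2) \<partial>lborel)" for n
  \<comment> \<open>Bounds the doubled squared averages uniformly in \<open>n\<close> and
    \<open>x\<close>, so its restriction to the ball is an integrable majorant.\<close>
  define Q where "Q = 2 * (K / \<delta> / c)"
  have mQ: "2 * (?m n x)\<^sup>2 \<le> Q" for n x
  proof -
    have "(?m n x)\<^sup>2 \<le> L2_inner lborel (fst (v n)) (fst (v n)) / c"
      unfolding c_def by (rule ball_average_sq_le[OF fL2(1) h(1)])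
    also have "\<dots> \<le> (K / \<delta>) / c"
      using c \<delta>(1) by (intro divide_right_mono order.trans[OF fL2(2)] K) auto
    finally show ?thesis by (simp add: Q_def)
  qed
  have intQ: "integrable lborel (\<lambda>x. indicator ?B x * Q)"
    using emeasure_lborel_cball_finite[of "0::pt" R] by (intro integrable_mult_left) auto
  have bdQ: "norm (indicator ?B x * (2 * (?m n x)\<^sup>2)) \<le> indicator ?B x * Q" for n x
    using mQ by (auto simp: indicator_def)
  have intJ: "integrable lborel (\<lambda>x. indicator ?B x * (2 * (?m n x)\<^sup>2))" for n
  proof (rule Bochner_Integration.integrable_bound[OF intQ])
    show "AE x in lborel. norm (indicator ?B x * (2 * (?m n x)\<^sup>2)) \<le> norm (indicator ?B x * Q)"
      by (intro AE_I2 order.trans[OF bdQ]) (simp only: real_norm_def abs_ge_self)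
  qed measurable
  have "J \<longlonglongrightarrow> (\<integral>x. 0 \<partial>(lborel :: pt measure))"
    unfolding J_def
  proof (rule integral_dominated_convergence[OF _ _ intQ])
    show "AE x in lborel. (\<lambda>n. indicator ?B x * (2 * (?m n x)\<^sup>2)) \<longlonglongrightarrow> 0"
    proof (rule AE_I2)
      fix x
      have "(\<lambda>n. indicator ?B x * (2 * (?m n x)\<^sup>2)) \<longlonglongrightarrow> indicator ?B x * (2 * 0\<^sup>2)"
        by (intro tendsto_intros avg0)
      then show "(\<lambda>n. indicator ?B x * (2 * (?m n x)\<^sup>2)) \<longlonglongrightarrow> 0" by simp
    qed
    show "AE x in lborel. norm (indicator ?B x * (2 * (?m n x)\<^sup>2)) \<le> indicator ?B x * Q" for n
      using bdQ by simp
  qed measurable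
  then have "\<forall>\<^sub>F n in sequentially. J n < e / 4"
    using e by (intro order_tendstoD(2)) auto
  then obtain n0 where n0: "\<And>n. n \<ge> n0 \<Longrightarrow> J n < e / 4" by (auto simp: eventually_sequentially)
  have "norm (L2_sq (fst (v n)) - 0) < e" if "n \<ge> n0" for n
  proof -
    define u where "u = fst (v n)"
    have [measurable]: "u \<in> borel_measurable borel" unfolding u_def by (rule fm)
    have [measurable]: "E (v n) \<in> borel_measurable borel" using L2_measurable[OF H1V_L2[OF v[of n]]] by simp
    let ?T = "\<lambda>x. \<integral>\<^sup>+z. ennreal ((u (z + x) - u x)\<^sup>2) * indicator (cball 0 h) z \<partial>lborel"
    \<comment> \<open>Exchanging the integrals leaves a translation estimate for each shift
      \<open>z\<close> of norm at most \<open>h\<close>.\<close>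
    have "(\<integral>\<^sup>+x. ?T x \<partial>lborel)
        = (\<integral>\<^sup>+z. \<integral>\<^sup>+x. ennreal ((u (z + x) - u x)\<^sup>2) * indicator (cball 0 h) z \<partial>lborel \<partial>lborel)"
      by (rule lborel_pair.Fubini') measurable
    also have "\<dots> \<le> (\<integral>\<^sup>+z. ennreal (3 * h\<^sup>2 * K) * indicator (cball (0::pt) h) z \<partial>lborel)"
    proof (rule nn_integral_mono)
      fix z :: pt
      show "(\<integral>\<^sup>+x. ennreal ((u (z + x) - u x)\<^sup>2) * indicator (cball 0 h) z \<partial>lborel)
          \<le> ennreal (3 * h\<^sup>2 * K) * indicator (cball (0::pt) h) z"
      proof (cases "norm z \<le> h")
        case True
        have "(norm z)\<^sup>2 * (3 * normV_sq V (v n)) \<le> h\<^sup>2 * (3 * K)"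
          using True K[of n] pos[of n] by (intro mult_mono power_mono) auto
        then show ?thesis
          using H1V_translation[OF v pos, of n z] True
          by (simp add: u_def) (erule order.trans, simp add: ac_simps ennreal_leI)
      qed simp
    qed
    also have "\<dots> = ennreal (3 * h\<^sup>2 * K) * ennreal c"
      by (subst nn_integral_cmult_indicator) (auto simp: ec)
    finally have T: "(\<integral>\<^sup>+x. ?T x \<partial>lborel) \<le> ennreal (3 * h\<^sup>2 * K) * ennreal c" .
    \<comment> \<open>Inside the ball average and deviation are used, outside it coercivity; adding
      the deviation and tail terms everywhere lets the integral split without case
      distinctions.\<close>
    have "(\<integral>\<^sup>+x. ennreal ((u x)\<^sup>2) \<partial>lborel)
        \<le> (\<integral>\<^sup>+x. ennreal (indicator ?B x * (2 * (?m n x)\<^sup>2)) + ennreal (2 / c) * ?T x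
              + ennreal (1 / L) * ennreal ((norm (E (v n) x))\<^sup>2) \<partial>lborel)"
    proof (rule nn_integral_mono)
      fix x
      show "ennreal ((u x)\<^sup>2) \<le> ennreal (indicator ?B x * (2 * (?m n x)\<^sup>2)) + ennreal (2 / c) * ?T x
              + ennreal (1 / L) * ennreal ((norm (E (v n) x))\<^sup>2)"
      proof (cases "x \<in> ?B")
        case True
        have "ennreal ((u x)\<^sup>2) \<le> ennreal (2 * (?m n x)\<^sup>2) + ennreal (2 / c) * ?T x"
          unfolding u_def c_def by (rule sq_le_ball_average[OF fL2(1) h(1)])
        then show ?thesis using True by (simp add: add_increasing2)
      next
        case False
        then have "norm x \<ge> R" by simp
        from fst_sq_le[OF L(1) R[OF this], of "v n"]
        have "ennreal ((u x)\<^sup>2) \<le> ennreal ((1 / L) * (norm (E (v n) x))\<^sup>2)"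
          unfolding u_def by (rule ennreal_leI)
        also have "\<dots> = ennreal (1 / L) * ennreal ((norm (E (v n) x))\<^sup>2)"
          using L(1) by (intro ennreal_mult) auto
        finally show ?thesis by (simp add: add_increasing)
      qed
    qed
    also have "\<dots> = (\<integral>\<^sup>+x. ennreal (indicator ?B x * (2 * (?m n x)\<^sup>2)) \<partial>lborel) + ennreal (2 / c) * (\<integral>\<^sup>+x. ?T x \<partial>lborel)
        + ennreal (1 / L) * (\<integral>\<^sup>+x. ennreal ((norm (E (v n) x))\<^sup>2) \<partial>lborel)"
      by (subst nn_integral_add, measurable, subst nn_integral_add, measurable, subst (1 2) nn_integral_cmult, measurable)
    also have "(\<integral>\<^sup>+x. ennreal (indicator ?B x * (2 * (?m n x)\<^sup>2)) \<partial>lborel) = ennreal (J n)"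
      unfolding J_def by (rule nn_integral_eq_integral[OF intJ]) simp
    also have "(\<integral>\<^sup>+x. ennreal ((norm (E (v n) x))\<^sup>2) \<partial>lborel) = ennreal (normV_sq V (v n))"
      unfolding normV_sq_eq by (rule nn_integral_L2[OF H1V_L2[OF v]])
    also have "ennreal (J n) + ennreal (2 / c) * (\<integral>\<^sup>+x. ?T x \<partial>lborel) + ennreal (1 / L) * ennreal (normV_sq V (v n))
        \<le> ennreal (e / 4) + ennreal (2 / c) * (ennreal (3 * h\<^sup>2 * K) * ennreal c) + ennreal (1 / L) * ennreal K"
      using n0[OF that] by (intro add_mono mult_left_mono T ennreal_leI K) auto
    also have "\<dots> = ennreal (e / 4 + (2 / c) * ((3 * h\<^sup>2 * K) * c) + (1 / L) * K)"
    proof -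
      have nn: "0 \<le> e / 4" "0 \<le> 2 / c" "0 \<le> 3 * h\<^sup>2 * K" "0 \<le> c" "0 \<le> 1 / L" "0 \<le> K"
        using e c Kpos L(1) by auto
      show ?thesis
        by (simp only: ennreal_plus[symmetric] ennreal_mult[symmetric] mult_nonneg_nonneg add_nonneg_nonneg nn)
    qed
    also have "e / 4 + (2 / c) * ((3 * h\<^sup>2 * K) * c) + (1 / L) * K = e / 4 + 6 * h\<^sup>2 * K + K / L"
      using c by simp
    also have "\<dots> = 3 / 4 * e" unfolding h(2) L(2) by simp
    finally have "(\<integral>\<^sup>+x. ennreal ((u x)\<^sup>2) \<partial>lborel) \<le> ennreal (3 / 4 * e)" .
    moreover have "(\<integral>\<^sup>+x. ennreal ((u x)\<^sup>2) \<partial>lborel) = ennreal (L2_sq u)"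
      unfolding L2_sq_def using fL2(1)[of n] by (intro nn_integral_eq_integral) (auto simp: L2_space_def u_def)
    ultimately have "L2_sq u \<le> 3 / 4 * e" using e by simp
    moreover have "0 \<le> L2_sq u" by (simp add: L2_sq_def)
    ultimately show ?thesis using e by (simp add: u_def)
  qed
  then show "\<exists>n0. \<forall>n\<ge>n0. norm (L2_sq (fst (v n)) - 0) < e" by blast
qed

text \<open>\<open>nonzeroV\<close> speaks of the function part only; a zero norm makes its weighted
  version vanish almost everywhere, and positivity of \<open>V\<close> removes the weight.\<close>

lemma normV_sq_pos:
  assumes v: "v \<in> H1V V" "nonzeroV v"
  shows "0 < normV_sq V v"
proof (rule ccontr)
  assume "\<not> ?thesis"
  then have "(\<integral>x. (norm (E v x))\<^sup>2 \<partial>lborel) = 0"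
    using L2_inner_self_nonneg[of lborel "E v"] by (simp add: normV_sq_eq flip: L2_inner_self)
  then have "AE x in lborel. (norm (E v x))\<^sup>2 = 0"
    using H1V_L2[OF v(1)] by (subst (asm) integral_nonneg_eq_0_iff_AE) (auto simp: L2_space_def)
  then have "AE x in lborel. fst v x = 0"
  proof eventually_elim
    fix x assume "(norm (E v x))\<^sup>2 = 0"
    then show "fst v x = 0" using V_pos[of x] by (simp add: weighted_pair_def prod_eq_iff)
  qed
  then show False using v(2) by (simp add: nonzeroV_def)
qed

end

text \<open>Coercivity settles the outside of a ball, compactness the inside.\<close>

lemma coercive_positive_lower_bound:
  fixes V :: "'a::euclidean_space \<Rightarrow> real"
  assumes cont: "continuous_on UNIV V" and pos: "\<And>x. V x > 0" and coercive: "filterlim V at_top at_infinity"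
  obtains \<delta> where "\<delta> > 0" "\<And>x. \<delta> \<le> V x"
proof -
  obtain R where R: "\<And>x. norm x \<ge> R \<Longrightarrow> 1 \<le> V x"
    using coercive unfolding filterlim_at_top eventually_at_infinity by blast
  have "\<exists>x0\<in>cball 0 \<bar>R\<bar>. \<forall>x\<in>cball 0 \<bar>R\<bar>. V x0 \<le> V x"
    by (rule continuous_attains_inf) (auto intro: continuous_on_subset[OF cont])
  then obtain x0 where "\<forall>x\<in>cball 0 \<bar>R\<bar>. V x0 \<le> V x" by blast
  then have x0: "V x0 \<le> V x" if "norm x \<le> \<bar>R\<bar>" for x using that by simp
  have "min 1 (V x0) \<le> V x" for x
    using R[of x] x0[of x] by (cases "norm x \<le> \<bar>R\<bar>") (auto simp: min_le_iff_disj)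
  then show thesis using pos[of x0] by (intro that[of "min 1 (V x0)"]) auto
qed

theorem lemma3p5:
  fixes p :: real and V :: "pt \<Rightarrow> real" and DV :: "pt \<Rightarrow> pt"
    and u :: "nat \<Rightarrow> (pt \<Rightarrow> real) \<times> (pt \<Rightarrow> pt)"
  assumes p: "p > 1"
    and V_C1: "\<forall>x. (V has_derivative (\<lambda>h. DV x \<bullet> h)) (at x)" "continuous_on UNIV DV"
    and V_pos: "\<forall>x. V x > 0"
    and V_coercive: "filterlim V at_top at_infinity"
    and V_grad: "\<exists>C>0. AE x in lborel. norm (DV x) \<le> C * V x powr (3/2)"
    and u_N: "\<forall>n. u n \<in> Nehari p V"
    and u_min: "(\<lambda>n. Ifun p V (u n)) \<longlonglongrightarrow> Inf (Ifun p V ` Nehari p V)"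
  shows "\<exists>r u0. strict_mono r \<and> u0 \<in> H1V V \<and> nonzeroV u0 \<and> weak_conv_V V (u \<circ> r) u0"
proof -
  have V_cont: "continuous_on UNIV V"
    using V_C1(1) by (intro continuous_at_imp_continuous_on ballI has_derivative_continuous) blast
  obtain C where C: "C > 0" "AE x in lborel. norm (DV x) \<le> C * V x powr (3/2)" using V_grad by blast
  interpret C1_potential V DV C
    using V_cont V_pos V_C1 C by unfold_locales auto
  obtain \<delta> where \<delta>: "\<delta> > 0" "\<And>x. \<delta> \<le> V x"
    using coercive_positive_lower_bound[OF V_cont _ V_coercive] V_pos by blast
  have uH: "u n \<in> H1V V" and nz: "nonzeroV (u n)"
    and eq: "normV_sq V (u n) = (p + 3) / (p + 1) * (L2_sq (fst (u n)) * nonlin p V (fst (u n)))" for n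
    using u_N by (simp_all add: Nehari_def mult.assoc)
  have pos: "0 < normV_sq V (u n)" for n by (rule normV_sq_pos[OF uH nz])
  have I: "Ifun p V (u n) = (1/2 - 1 / (p + 3)) * normV_sq V (u n)" for n
  proof -
    have "1 / (p + 1) * L2_sq (fst (u n)) * nonlin p V (fst (u n)) = 1 / (p + 3) * normV_sq V (u n)"
      unfolding eq using p by simp
    then show ?thesis unfolding Ifun_def by (simp add: left_diff_distrib)
  qed
  have a: "1/2 - 1 / (p + 3) > 0" using p by (simp add: field_simps)
  \<comment> \<open>Convergence of the energies enters as boundedness, which the positive factor in
    \<open>I\<close> passes on to the norms.\<close>
  have "Bseq (\<lambda>n. Ifun p V (u n))" using u_min by (intro convergent_imp_Bseq convergentI)
  then obtain B where B: "\<And>n. norm (Ifun p V (u n)) \<le> B" by (auto simp: Bseq_def)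
  define K where "K = B / (1/2 - 1 / (p + 3))"
  have K: "normV_sq V (u n) \<le> K" for n
    using B[of n] a unfolding I K_def by (simp add: pos_le_divide_eq mult.commute)
  have K0: "K \<ge> 0" using K[of 0] pos[of 0] by linarith
  obtain r u0 where r: "strict_mono (r :: nat \<Rightarrow> nat)" and u0: "u0 \<in> H1V V"
    and weak: "\<And>w. w \<in> L2E \<Longrightarrow> (\<lambda>n. L2_inner lborel (E (u (r n))) w) \<longlonglongrightarrow> L2_inner lborel (E u0) w"
    using H1V_weakly_compact[of u K, OF uH K] by blast
  have "nonzeroV u0"
  proof (rule ccontr)
    assume "\<not> nonzeroV u0"
    then have zero: "AE x in lborel. fst u0 x = 0" by (simp add: nonzeroV_def)
    have lim: "(\<lambda>n. L2_sq (fst (u (r n)))) \<longlonglongrightarrow> 0"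
      by (rule weakly_null_imp_L2_null[OF \<delta> V_coercive uH pos K weak zero])
    obtain D where D: "D \<ge> 0" and Db: "\<And>v. v \<in> H1V V \<Longrightarrow> 0 < normV_sq V v \<Longrightarrow> normV_sq V v \<le> K \<Longrightarrow>
        nonlin p V (fst v) \<le> D * normV_sq V v"
      using nonlin_bound[OF K0, of p] p by auto
    \<comment> \<open>The bound on \<open>nonlin\<close> is linear in the squared norm, so this
      positive quantity cancels from the Nehari identity and a lower bound for \<open>L2_sq\<close>,
      valid for every \<open>n\<close>, remains.\<close>
    have ge: "1 \<le> (p + 3) / (p + 1) * D * L2_sq (fst (u n))" for n
    proof -
      have "normV_sq V (u n) \<le> (p + 3) / (p + 1) * (L2_sq (fst (u n)) * (D * normV_sq V (u n)))"
        using Db[OF uH pos K, of n] p by (subst eq, intro mult_left_mono) (auto simp: L2_sq_def)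
      then have "1 * normV_sq V (u n) \<le> ((p + 3) / (p + 1) * D * L2_sq (fst (u n))) * normV_sq V (u n)"
        by (simp add: ac_simps)
      then show ?thesis using pos[of n] by (simp only: mult_le_cancel_right_pos)
    qed
    have "(\<lambda>n. (p + 3) / (p + 1) * D * L2_sq (fst (u (r n)))) \<longlonglongrightarrow> (p + 3) / (p + 1) * D * 0"
      by (intro tendsto_intros lim)
    then have "1 \<le> (p + 3) / (p + 1) * D * 0" by (rule LIMSEQ_le_const) (use ge in auto)
    then show False by simp
  qed
  moreover have "weak_conv_V V (u \<circ> r) u0"
    using weak H1V_L2 by (auto simp: weak_conv_V_def innerV_eq)
  ultimately show ?thesis using r u0 by blast
qed

end
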